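(* Consider the single-server ($K=1$) task-based flow-time-plus-energy problem described in the context, with power function $P(s)=s^\alpha$ where $1<\alpha<2$. Then the online algorithm described in the context has competitive ratio at most $8+\frac{4}{2-\alpha}+3^{\alpha}$.
   Context: Model: a single server that may process several tasks simultaneously, each task $x$ being processed at its own rate $s_x(t)$; the server's total speed is $s(t)=\sum_x s_x(t)$ and it consumes power $P(s(t))$. A finite set of jobs is given; job $i$ is released at time $a_i$ and consists of $m_i$ map tasks and $\mathsf r$ reduce tasks with arbitrary positive sizes (work); every job has the same number $\mathsf r$ of reduce tasks (a standing assumption of this setting). MapReduce constraint: a reduce task of job $i$ may be processed only after all map tasks of job $i$ are completed; a reduce task is free once all map tasks of its job are completed. Preemption is allowed. The flow time of a task of job $i$ completed at time $c$ is $c-a_i$. The task-based cost is $\int n(t)\,dt+\int P(s(t))\,dt$, where $n(t)$ is the number of unfinished (map or reduce) tasks. An online algorithm learns about job $i$ only at time $a_i$. The competitive ratio of $A$ is $\sup_\sigma C^A(\sigma)/C^{\mathsf{OPT}}(\sigma)$, where $\mathsf{OPT}$ is the minimum cost over all feasible schedules chosen with full knowledge of the input. Algorithm: at time $t$ let $m(t)$ be the number of unfinished map tasks (over all jobs), $r_f(t)$ the number of unfinished free reduce tasks, and $J(t)$ the number of jobs with at least one unfinished map task. The cumulative remaining map size of a job is the sum of the remaining sizes of its map tasks. The algorithm simultaneously processes: ($M_1$) the unfinished map task with the smallest remaining size, at rate $P^{-1}(m(t)+1)$; ($M_2$) the shortest remaining map task of the job with the smallest cumulative remaining map size, at rate $P^{-1}(\mathsf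 r J(t)+1)$; ($R_f$) the free reduce task with the smallest remaining size, at rate $P^{-1}(r_f(t)+1)$. (If $M_1$ and $M_2$ coincide, only two tasks are processed.) The total speed is the sum of these rates. *)

theory Defs
  imports "HOL-Analysis.Analysis"
begin

text \<open>A MapReduce instance on a single server.  Jobs are numbered 0, ..., njobs-1.
  Job i is released at time rel i, has nmap i map tasks with sizes msize i k (k < nmap i)
  and nred reduce tasks (the same number for every job) with sizes rsize i k (k < nred).\<close>
record mrinst =
  njobs :: nat
  rel   :: "nat \<Rightarrow> real"
  nmap  :: "nat \<Rightarrow> nat"
  nred  :: nat
  msize :: "nat \<Rightarrow> nat \<Rightarrow> real"
  rsize :: "nat \<Rightarrow> nat \<Rightarrow> real"

datatype task = MapT nat nat | RedT nat nat

fun job :: "task \<Rightarrow> nat" where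
  "job (MapT i k) = i" | "job (RedT i k) = i"

fun is_map :: "task \<Rightarrow> bool" where
  "is_map (MapT i k) = True" | "is_map (RedT i k) = False"

definition tasks :: "mrinst \<Rightarrow> task set" where
  "tasks I = {MapT i k | i k. i < njobs I \<and> k < nmap I i}
           \<union> {RedT i k | i k. i < njobs I \<and> k < nred I}"

fun tsize :: "mrinst \<Rightarrow> task \<Rightarrow> real" where
  "tsize I (MapT i k) = msize I i k" | "tsize I (RedT i k) = rsize I i k"

definition release :: "mrinst \<Rightarrow> task \<Rightarrow> real" where
  "release I x = rel I (job x)"

definition valid_instance :: "mrinst \<Rightarrow> bool" where
  "valid_instance I \<longleftrightarrow> (\<forall>x \<in> tasks I. 0 < tsize I x)"

text \<open>A schedule assigns to each task x its processing rate s_x(t) at time t.\<close>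
type_synonym schedule = "task \<Rightarrow> real \<Rightarrow> real"

definition work :: "schedule \<Rightarrow> task \<Rightarrow> real \<Rightarrow> ennreal" where
  "work S x t = (\<integral>\<^sup>+ u. ennreal (S x u) * indicator {..t} u \<partial>lborel)"

definition is_done :: "mrinst \<Rightarrow> schedule \<Rightarrow> task \<Rightarrow> real \<Rightarrow> bool" where
  "is_done I S x t \<longleftrightarrow> ennreal (tsize I x) \<le> work S x t"

definition unfinished :: "mrinst \<Rightarrow> schedule \<Rightarrow> task \<Rightarrow> real \<Rightarrow> bool" where
  "unfinished I S x t \<longleftrightarrow> x \<in> tasks I \<and> release I x \<le> t \<and> \<not> is_done I S x t"

definition feasible :: "mrinst \<Rightarrow> schedule \<Rightarrow> bool" where
  "feasible I S \<longleftrightarrow>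
     (\<forall>x. S x \<in> borel_measurable lborel) \<and>
     (\<forall>x t. 0 \<le> S x t) \<and>
     (\<forall>x t. t < release I x \<longrightarrow> S x t = 0) \<and>
     (\<forall>i k t. S (RedT i k) t \<noteq> 0 \<longrightarrow> (\<forall>k' < nmap I i. is_done I S (MapT i k') t))"

definition cost :: "mrinst \<Rightarrow> real \<Rightarrow> schedule \<Rightarrow> ennreal" where
  "cost I \<alpha> S = (\<integral>\<^sup>+ t. ennreal (real (card {x. unfinished I S x t})
                         + (\<Sum>x\<in>tasks I. S x t) powr \<alpha>) \<partial>lborel)"

definition OPT :: "mrinst \<Rightarrow> real \<Rightarrow> ennreal" where
  "OPT I \<alpha> = (INF S \<in> {S. feasible I S}. cost I \<alpha> S)"

definition rem :: "mrinst \<Rightarrow> schedule \<Rightarrow> task \<Rightarrow> real \<Rightarrow> real" where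
  "rem I S x t = tsize I x - enn2real (work S x t)"

definition umaps :: "mrinst \<Rightarrow> schedule \<Rightarrow> real \<Rightarrow> task set" where
  "umaps I S t = {x. unfinished I S x t \<and> is_map x}"

definition freereds :: "mrinst \<Rightarrow> schedule \<Rightarrow> real \<Rightarrow> task set" where
  "freereds I S t = {x. unfinished I S x t \<and> \<not> is_map x \<and>
                        (\<forall>k < nmap I (job x). is_done I S (MapT (job x) k) t)}"

definition ajobs :: "mrinst \<Rightarrow> schedule \<Rightarrow> real \<Rightarrow> nat set" where
  "ajobs I S t = job ` umaps I S t"

definition cumrem :: "mrinst \<Rightarrow> schedule \<Rightarrow> nat \<Rightarrow> real \<Rightarrow> real" where
  "cumrem I S i t = (\<Sum>x \<in> {y \<in> umaps I S t. job y = i}. rem I S x t)"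

text \<open>S follows the algorithm: at every time t the rates are those prescribed by M1, M2, Rf
  (for some choice among ties); if M1 and M2 pick the same task, its rate is the sum.\<close>
definition alg_rule :: "mrinst \<Rightarrow> real \<Rightarrow> schedule \<Rightarrow> bool" where
  "alg_rule I \<alpha> S \<longleftrightarrow> (\<forall>t. \<exists>x1 x2 x3.
     (umaps I S t \<noteq> {} \<longrightarrow>
        x1 \<in> umaps I S t \<and> (\<forall>y \<in> umaps I S t. rem I S x1 t \<le> rem I S y t) \<and>
        x2 \<in> umaps I S t \<and> (\<forall>j \<in> ajobs I S t. cumrem I S (job x2) t \<le> cumrem I S j t) \<and>
        (\<forall>y \<in> umaps I S t. job y = job x2 \<longrightarrow> rem I S x2 t \<le> rem I S y t)) \<and>
     (freereds I S t \<noteq> {} \<longrightarrow>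
        x3 \<in> freereds I S t \<and> (\<forall>y \<in> freereds I S t. rem I S x3 t \<le> rem I S y t)) \<and>
     (\<forall>x. S x t =
          (if umaps I S t \<noteq> {} \<and> x = x1
             then (real (card (umaps I S t)) + 1) powr (1/\<alpha>) else 0)
        + (if umaps I S t \<noteq> {} \<and> x = x2
             then (real (nred I * card (ajobs I S t)) + 1) powr (1/\<alpha>) else 0)
        + (if freereds I S t \<noteq> {} \<and> x = x3
             then (real (card (freereds I S t)) + 1) powr (1/\<alpha>) else 0)))"

end

theory Submission
  imports Defs
begin

text \<open>
  Amortised analysis against an arbitrary feasible schedule of finite cost. If \<open>D q\<close> is the number
  of items whose remaining size under the algorithm is at least \<open>q\<close>, minus the same number for
  the competitor, the potential is the integral over \<open>q > 0\<close> of a convex function \<open>f (D q)\<close>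
  with increments \<open>f k - f (k - 1) = P' (P\<^sup>-\<^sup>1 (c k)) = \<alpha> (c k)\<^bsup>1 - 1/\<alpha>\<^esup>\<close>. Unreleased items
  cancel in \<open>D\<close>, so arrivals cause no jump. Processing the smallest of \<open>n\<close> items at
  rate \<open>P\<^sup>-\<^sup>1 (c n + 1)\<close> lowers the potential at rate at least \<open>\<alpha> c (n - n')\<close> where \<open>n'\<close> counts the
  competitor's items, whereas by Young's inequality the competitor, running at speed \<open>s\<close>, raises
  it at rate at most \<open>s\<^bsup>\<alpha>\<^esup> + (\<alpha> - 1) c n\<close>.

  This is applied to map tasks (\<open>M\<^sub>1\<close>), to jobs measured by their cumulative
  remaining map size with \<open>c = r\<close> (\<open>M\<^sub>2\<close>), and to all reduce tasks (\<open>R\<^sub>f\<close>). In the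
  last case the reduce tasks that are not yet free, \<open>r J\<close> in number, leave an excess
  \<open>(\<alpha> - 1) r J\<close>, which is paid for by giving the second potential the weight \<open>\<alpha>\<close> relative to the third.
  Since the competitor is merely measurable, the drift is controlled at almost every time only.
\<close>

section \<open>Almost everywhere Dini derivatives\<close>

text \<open>Lebesgue differentiation along the one-sided intervals \<open>[t, t + h]\<close>. The
  difference quotient is cleared of its denominator, so that the bound can be summed over tasks and
  used directly as a Dini estimate. The exceptional set is Lebesgue negligible, and the claim passes
  from the completed measure to \<open>lborel\<close>.\<close>

lemma AE_right_derivative_integral:
  fixes f :: "real \<Rightarrow> real"
  assumes "\<And>a b. f integrable_on {a..b}"
  shows "AE t in lborel. \<forall>e>0. eventually (\<lambda>u. \<bar>integral {t..u} f - (u - t) * f t\<bar> \<le> e * (u - t)) (at_right t)"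
proof -
  obtain N where N: "negligible N" and
    D: "\<And>x e. \<lbrakk>x \<notin> N; 0 < e\<rbrakk> \<Longrightarrow> \<exists>d>0. \<forall>h. 0 < h \<and> h < d \<longrightarrow>
          norm (integral (cbox x (x + h *\<^sub>R One)) f /\<^sub>R h ^ DIM(real) - f x) < e"
    using integrable_ccontinuous_explicit[of f] assms by (metis box_real(2))
  have *: "eventually (\<lambda>u. \<bar>integral {t..u} f - (u - t) * f t\<bar> \<le> e * (u - t)) (at_right t)"
    if te: "t \<notin> N" "0 < e" for t e
  proof -
    obtain d where "d > 0" and d: "\<And>h. 0 < h \<Longrightarrow> h < d \<Longrightarrow>
        \<bar>integral {t..t + h} f / h - f t\<bar> < e"
      using D[OF te] by (auto simp: divide_inverse mult.commute)
    have "\<bar>integral {t..u} f - (u - t) * f t\<bar> \<le> e * (u - t)" if u: "t < u" "u < t + d" for u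
    proof -
      have "\<bar>integral {t..u} f / (u - t) - f t\<bar> < e"
        using d[of "u - t"] u by simp
      moreover have "integral {t..u} f - (u - t) * f t = (integral {t..u} f / (u - t) - f t) * (u - t)"
        using u by (simp add: field_simps)
      ultimately show ?thesis using u
        by (simp add: abs_mult mult_right_mono)
    qed
    then show ?thesis
      using \<open>d > 0\<close> unfolding eventually_at_right_field by (intro exI[of _ "t + d"]) auto
  qed
  have "AE t in lebesgue. t \<notin> N"
    using N by (simp add: AE_not_in negligible_iff_null_sets)
  then have "AE t in lborel. t \<notin> N"
    by (simp add: AE_completion_iff)
  then show ?thesis
    by eventually_elim (use * in blast)
qed

text \<open>Continuous induction from \<open>a\<close> to \<open>b\<close>: outside \<open>N\<close> a step is covered by the Dini bound, and inside an
  open set \<open>U \<supseteq> N\<close> of small \<open>M\<close>-measure by \<open>incr\<close>.\<close>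

lemma nonincreasing_from_AE_Dini:
  fixes F :: "real \<Rightarrow> real" and M :: "real measure"
  assumes fin: "finite_measure M" and sets: "sets M = sets borel" and ab: "a \<le> b"
    and atom: "\<And>x. emeasure M {x} = 0"
    and incr: "\<And>x y. a \<le> x \<Longrightarrow> x \<le> y \<Longrightarrow> y \<le> b \<Longrightarrow> F y - F x \<le> measure M {x<..y}"
    and N: "N \<in> null_sets M"
    and dini: "\<And>t e. \<lbrakk>a \<le> t; t < b; t \<notin> N; e > 0\<rbrakk> \<Longrightarrow>
        eventually (\<lambda>u. F u \<le> F t + e * (u - t)) (at_right t)"
  shows "F b \<le> F a"
proof -
  interpret finite_measure M by fact
  \<comment> \<open>\<open>e * (b - a)\<close> collects the errors of the Dini steps; the second
    \<open>e\<close> bounds the measure of the open set around \<open>N\<close>.\<close>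
  have key: "F b - F a \<le> e * (b - a) + e" if e: "e > 0" for e
  proof -
    have "emeasure M N = (INF U\<in>{U. N \<subseteq> U \<and> open U}. emeasure M U)"
      using N by (intro outer_regular) (auto simp: sets null_sets_def)
    moreover have "emeasure M N = 0" using N by (auto simp: null_sets_def)
    ultimately have "(INF U\<in>{U. N \<subseteq> U \<and> open U}. emeasure M U) < ennreal e"
      using e by simp
    then obtain U where U: "N \<subseteq> U" "open U" and "emeasure M U < ennreal e"
      by (auto simp: INF_less_iff)
    then have mU: "measure M U \<le> e"
      using e by (simp add: emeasure_eq_measure ennreal_less_iff)
    have Us[measurable]: "U \<in> sets M" using U sets by simp
    have Is: "{x<..y} \<in> sets M" for x y using sets by simp
    \<comment> \<open>\<open>B\<close> is the increase allowed up to time \<open>t\<close>: slope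
      \<open>e\<close> everywhere, plus the measure of the part of \<open>U\<close> already
      passed.\<close>
    define B where "B t = e * (t - a) + measure M ({a<..t} \<inter> U)" for t
    have Bmono: "B s \<le> B t" if "s \<le> t" for s t
      unfolding B_def using that e Is Us
      by (intro add_mono mult_left_mono finite_measure_mono) auto
    define G where "G = {t\<in>{a..b}. F t - F a \<le> B t}"
    have aG: "a \<in> G" using ab by (simp add: G_def B_def)
    have bdd: "bdd_above G" unfolding G_def by (intro bdd_aboveI[of _ b]) auto
    define s where "s = Sup G"
    have sab: "a \<le> s" "s \<le> b"
      using aG bdd by (auto simp: s_def intro!: cSup_upper cSup_least) (auto simp: G_def)
    \<comment> \<open>\<open>F\<close> need not be continuous. Points of \<open>G\<close> lie
      arbitrarily close below \<open>s\<close> (or equal it), and by \<open>incr\<close> the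
      increase from such a point to \<open>s\<close> is at most the measure of a half-open interval
      shrinking to \<open>{s}\<close>, which tends to 0 because \<open>M\<close> has no
      atoms.\<close>
    have sG: "s \<in> G"
    proof -
      have "F s - F a \<le> B s + d" if d: "d > 0" for d
      proof -
        have "(\<lambda>n. measure M {s - 1 / real (Suc n)<..s}) \<longlonglongrightarrow> measure M (\<Inter>n. {s - 1 / real (Suc n)<..s})"
        proof (intro finite_Lim_measure_decseq)
          show "decseq (\<lambda>n. {s - 1 / real (Suc n)<..s})"
          proof (intro antimonoI subsetI)
            fix m n :: nat and x assume "m \<le> n" "x \<in> {s - 1 / real (Suc n)<..s}"
            moreover from this have "1 / real (Suc n) \<le> 1 / real (Suc m)"
              by (simp add: frac_le)
            ultimately show "x \<in> {s - 1 / real (Suc m)<..s}" by auto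
          qed
        qed (use Is in auto)
        moreover have "(\<Inter>n. {s - 1 / real (Suc n)<..s}) = {s}"
        proof -
          have "x = s" if "\<And>n. s - 1 / real (Suc n) < x" "x \<le> s" for x
          proof (rule ccontr)
            assume "x \<noteq> s"
            then have "s - x > 0" using that by simp
            then obtain n where "1 / real (Suc n) < s - x"
              using nat_approx_posE by blast
            then show False using that(1)[of n] by simp
          qed
          then show ?thesis by auto
        qed
        ultimately have "(\<lambda>n. measure M {s - 1 / real (Suc n)<..s}) \<longlonglongrightarrow> 0"
          using atom[of s] by (simp add: measure_def)
        then have "\<forall>\<^sub>F n in sequentially. measure M {s - 1 / real (Suc n)<..s} < d"
          using d by (simp add: order_tendsto_iff)
        then obtain n where n: "measure M {s - 1 / real (Suc n)<..s} < d"
          by (auto simp: eventually_sequentially)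
        obtain t where t: "t \<in> G" "s - 1 / real (Suc n) < t"
          using less_cSupD[of G "s - 1 / real (Suc n)"] aG s_def by auto
        have ts: "t \<le> s" using t bdd by (simp add: s_def cSup_upper)
        have "F s - F t \<le> measure M {t<..s}"
          using t ts sab by (intro incr) (auto simp: G_def)
        also have "\<dots> \<le> measure M {s - 1 / real (Suc n)<..s}"
          using t Is by (intro finite_measure_mono) auto
        finally show ?thesis using t(1) n Bmono[OF ts] by (auto simp: G_def)
      qed
      then have "F s - F a \<le> B s" by (rule field_le_epsilon)
      then show ?thesis using sab by (simp add: G_def)
    qed
    have "s = b"
    proof (rule ccontr)
      assume "s \<noteq> b"
      then have sb: "s < b" using sab by simp
      have "\<exists>u>s. u \<le> b \<and> F u - F a \<le> B u"
      proof (cases "s \<in> N")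
        case False
        have "eventually (\<lambda>u. F u \<le> F s + e * (u - s)) (at_right s)"
          using dini sab sb False e by blast
        then have "eventually (\<lambda>u. F u \<le> F s + e * (u - s) \<and> s < u \<and> u < b) (at_right s)"
          using sb by (intro eventually_conj) (auto simp: eventually_at_right_field)
        then obtain u where u: "F u \<le> F s + e * (u - s)" "s < u" "u < b"
          using eventually_happens'[OF trivial_limit_at_right_real[of s]] by blast
        have "measure M ({a<..s} \<inter> U) \<le> measure M ({a<..u} \<inter> U)"
          using u Is Us by (intro finite_measure_mono) auto
        then have "F u - F a \<le> B u"
          using u sG unfolding G_def B_def by (auto simp: algebra_simps)
        then show ?thesis using u by force
      next
        case True
        then obtain d where d: "d > 0" "ball s d \<subseteq> U" using U
          by (meson open_contains_ball_eq subsetD)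
        define u where "u = min b (s + d / 2)"
        have u: "s < u" "u \<le> b" "{s<..u} \<subseteq> U"
          using d sb by (auto simp: u_def dist_real_def subset_eq)
        have "measure M ({a<..s} \<inter> U) + measure M {s<..u} = measure M (({a<..s} \<inter> U) \<union> {s<..u})"
          using Is Us by (intro finite_measure_Union[symmetric]) auto
        also have "({a<..s} \<inter> U) \<union> {s<..u} = {a<..u} \<inter> U"
          using u sab by auto
        finally have "measure M ({a<..u} \<inter> U) = measure M ({a<..s} \<inter> U) + measure M {s<..u}" ..
        moreover have "F u - F s \<le> measure M {s<..u}" using incr u sab by simp
        moreover have "e * (s - a) \<le> e * (u - a)" using u e by simp
        ultimately have "F u - F a \<le> B u"
          using sG unfolding G_def B_def by auto
        then show ?thesis using u by blast
      qed
      then obtain u where "u > s" "u \<in> G" using sab by (auto simp: G_def)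
      then show False using bdd cSup_upper s_def by fastforce
    qed
    then have "F b - F a \<le> B b" using sG by (simp add: G_def)
    moreover have "measure M ({a<..b} \<inter> U) \<le> measure M U"
      using Is Us by (intro finite_measure_mono) auto
    ultimately show ?thesis using mU by (simp add: B_def)
  qed
  have "F b - F a \<le> 0 + d" if "d > 0" for d
  proof -
    \<comment> \<open>With this value of \<open>e\<close> the bound in \<open>key\<close> equals
      \<open>d\<close>.\<close>
    have "d / (b - a + 1) > 0" using that ab by simp
    from key[OF this] have "F b - F a \<le> d / (b - a + 1) * (b - a + 1)"
      by (simp only: distrib_left mult_1_right)
    then show ?thesis using ab by simp
  qed
  then show ?thesis using field_le_epsilon[of "F b - F a" 0] by simp
qed

text \<open>The preceding lemma is applied to \<open>\<Phi>\<close> minus the integral of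
  \<open>g\<close>, whose upper right Dini derivative is at most 0 almost everywhere. Almost
  everywhere bounds alone would admit a Cantor function; \<open>incr\<close> excludes this by
  dominating the growth of \<open>\<Phi>\<close> by that of an absolutely continuous
  function.\<close>

lemma AE_Dini_le_integral:
  fixes \<Phi> g G :: "real \<Rightarrow> real"
  assumes ab: "a \<le> b"
    and G: "set_integrable lborel {a..b} G" and Gpos: "\<And>x. 0 \<le> G x"
    and g: "set_integrable lborel {a..b} g"
    and incr: "\<And>x y. a \<le> x \<Longrightarrow> x \<le> y \<Longrightarrow> y \<le> b \<Longrightarrow> \<Phi> y - \<Phi> x \<le> integral {x..y} G"
    and dini: "AE t in lborel. t \<in> {a..<b} \<longrightarrow>
        (\<forall>e>0. eventually (\<lambda>u. \<Phi> u \<le> \<Phi> t + (u - t) * (g t + e)) (at_right t))"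
  shows "\<Phi> b - \<Phi> a \<le> integral {a..b} g"
proof -
  define g' where "g' x = indicator {a..b} x * g x" for x
  define H where "H x = indicator {a..b} x * (G x + \<bar>g x\<bar>)" for x
  have g'i: "integrable lborel g'"
    using g by (simp add: set_integrable_def g'_def[abs_def])
  have Hi: "integrable lborel H"
  proof -
    have "set_integrable lborel {a..b} (\<lambda>x. G x + \<bar>g x\<bar>)"
      using G g by (intro set_integral_add set_integrable_abs)
    then show ?thesis by (simp add: set_integrable_def H_def[abs_def])
  qed
  have Hm[measurable]: "H \<in> borel_measurable borel" using Hi by simp
  have Hpos: "0 \<le> H x" for x using Gpos[of x] by (simp add: H_def)
  \<comment> \<open>The density is \<open>G + \<bar>g\<bar>\<close> on \<open>{a..b}\<close>: this
    measure has no atoms, vanishes on \<open>lborel\<close>-null sets, and dominates the increments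
    of \<open>\<Phi>\<close> minus the integral of \<open>g\<close>.\<close>
  define M where "M = density lborel (\<lambda>x. ennreal (H x))"
  have Mset: "emeasure M A = ennreal (set_lebesgue_integral lborel A H)" if "A \<in> sets borel" for A
  proof -
    have "set_integrable lborel A H"
      unfolding set_integrable_def using that Hi by (intro integrable_mult_indicator) auto
    have "emeasure M A = (\<integral>\<^sup>+x. ennreal (H x) * indicator A x \<partial>lborel)"
      using that by (simp add: M_def emeasure_density)
    also have "\<dots> = (\<integral>\<^sup>+x. ennreal (indicator A x * H x) \<partial>lborel)"
      by (intro nn_integral_cong) (auto split: split_indicator)
    also have "\<dots> = ennreal (set_lebesgue_integral lborel A H)"
      unfolding set_lebesgue_integral_def using \<open>set_integrable lborel A H\<close> Hpos
      by (subst nn_integral_eq_integral) (auto simp: set_integrable_def)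
    finally show ?thesis .
  qed
  have sint: "set_lebesgue_integral lborel A H = integral A H" "H integrable_on A" if "A \<in> sets borel" for A
    using set_borel_integral_eq_integral[of A H] integrable_mult_indicator[of A lborel H] that Hi
    by (auto simp: set_integrable_def)
  interpret M: finite_measure M
  proof (rule finite_measureI)
    have "space M = UNIV" by (simp add: M_def)
    then show "emeasure M (space M) \<noteq> \<infinity>"
      by (simp add: Mset[of UNIV] infinity_ennreal_def)
  qed
  have ipos: "0 \<le> integral A H" if "A \<in> sets borel" for A
    using sint(2)[OF that] Hpos by (intro integral_nonneg) auto
  have mM: "measure M {x<..y} = integral {x..y} H" for x y
  proof -
    have "integral {x<..y} H = integral {x..y} H"
      by (intro integral_spike_set) (auto intro: negligible_subset[of "{x}"])
    then show ?thesis
      using ipos[of "{x<..y}"] by (simp add: measure_def Mset sint)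
  qed
  define F where "F t = \<Phi> t - integral {a..t} g'" for t
  have g'int: "g' integrable_on {x..y}" for x y
    using set_borel_integral_eq_integral(1)[of "{x..y}" g'] integrable_mult_indicator[of "{x..y}" lborel g'] g'i
    by (simp add: set_integrable_def)
  have Fdiff: "F y - F x = \<Phi> y - \<Phi> x - integral {x..y} g'" if "a \<le> x" "x \<le> y" for x y
  proof -
    have "integral {a..x} g' + integral {x..y} g' = integral {a..y} g'"
      using that g'int by (intro Henstock_Kurzweil_Integration.integral_combine) auto
    then show ?thesis by (simp add: F_def)
  qed
  have g'AE: "AE t in lborel. \<forall>e>0. eventually (\<lambda>u. \<bar>integral {t..u} g' - (u - t) * g' t\<bar> \<le> e * (u - t)) (at_right t)"
    by (rule AE_right_derivative_integral) (rule g'int)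
  define Q where "Q t \<longleftrightarrow> (t \<in> {a..<b} \<longrightarrow> (\<forall>e>0. eventually (\<lambda>u. F u \<le> F t + e * (u - t)) (at_right t)))" for t
  have "AE t in lborel. Q t"
    using g'AE dini
  proof eventually_elim
    case (elim t)
    show "Q t"
      unfolding Q_def
    proof (intro impI allI)
      fix e :: real assume t: "t \<in> {a..<b}" and e: "e > 0"
      have "eventually (\<lambda>u. \<bar>integral {t..u} g' - (u - t) * g' t\<bar> \<le> e / 2 * (u - t)) (at_right t)"
        using elim(1) e by (meson half_gt_zero)
      moreover have "eventually (\<lambda>u. \<Phi> u \<le> \<Phi> t + (u - t) * (g t + e / 2)) (at_right t)"
        using elim(2) t e by (meson half_gt_zero)
      moreover have "eventually (\<lambda>u. t < u) (at_right t)"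
        by (rule eventually_at_right_less)
      ultimately show "eventually (\<lambda>u. F u \<le> F t + e * (u - t)) (at_right t)"
      proof eventually_elim
        case (elim u)
        have "g' t = g t" using t by (simp add: g'_def)
        then have "(u - t) * g t - integral {t..u} g' \<le> e / 2 * (u - t)"
          using elim(1) by (simp only: abs_le_iff) linarith
        then have "\<Phi> u - \<Phi> t - integral {t..u} g' \<le> e * (u - t)"
          using elim(2) by (simp add: field_simps)
        then show ?case using Fdiff[of t u] t elim by simp
      qed
    qed
  qed
  then obtain N where N: "{t. \<not> Q t} \<subseteq> N" "N \<in> null_sets lborel"
    by (auto simp: eventually_ae_filter)
  have "F b \<le> F a"
  proof (rule nonincreasing_from_AE_Dini[where M = M and N = N and F = F and a = a and b = b])
    show "finite_measure M" by (rule M.finite_measure_axioms)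
    show "sets M = sets borel" by (simp add: M_def)
    show "emeasure M {x} = 0" for x
      using Mset[of "{x}"] sint[of "{x}"] by simp
    show "N \<in> null_sets M"
      using N(2) unfolding M_def by (subst null_sets_density_iff) (auto simp: AE_iff_null intro: AE_not_in[THEN AE_mp])
    show "F y - F x \<le> measure M {x<..y}" if "a \<le> x" "x \<le> y" "y \<le> b" for x y
    proof -
      have Gi: "G integrable_on {x..y}" 
        using set_borel_integral_eq_integral(1)[OF G] that
        by (rule_tac integrable_on_subinterval[of _ "{a..b}"]) auto
      have "integral {x..y} G + integral {x..y} (\<lambda>u. - g' u) = integral {x..y} (\<lambda>u. G u + - g' u)"
        using Gi g'int by (intro integral_add[symmetric] integrable_neg) auto
      also have "\<dots> \<le> integral {x..y} H"
        using that
        by (intro integral_le integrable_add integrable_neg Gi g'int sint(2)) (auto simp: H_def g'_def)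
      finally have "integral {x..y} G - integral {x..y} g' \<le> integral {x..y} H" by simp
      then show ?thesis using incr[OF that] Fdiff[OF that(1,2)] by (simp add: mM)
    qed
    show "\<forall>\<^sub>F u in at_right t. F u \<le> F t + e * (u - t)" if "a \<le> t" "t < b" "t \<notin> N" "0 < e" for t e
      using that N(1) by (auto simp: Q_def)
  qed (rule ab)
  moreover have "integral {a..b} g' = integral {a..b} g"
    by (intro integral_cong) (simp add: g'_def)
  ultimately show ?thesis using Fdiff[of a b] ab by simp
qed

section \<open>A convex potential on remaining sizes\<close>

text \<open>For \<open>w 0 = 0\<close> this is the convex function that vanishes on \<open>x \<le> 0\<close> and has slope \<open>w k\<close> on
  \<open>[k - 1, k]\<close> (up to \<open>k = n\<close>).\<close>

definition hinge_sum :: "(nat \<Rightarrow> real) \<Rightarrow> nat \<Rightarrow> real \<Rightarrow> real" where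
  "hinge_sum w n x = (\<Sum>j<n. (w (Suc j) - w j) * max 0 (x - real j))"

lemma hinge_sum_nonneg: "mono w \<Longrightarrow> 0 \<le> hinge_sum w n x"
  unfolding hinge_sum_def by (intro sum_nonneg mult_nonneg_nonneg) (auto dest: incseq_SucD)

lemma hinge_sum_mono: "mono w \<Longrightarrow> x \<le> y \<Longrightarrow> hinge_sum w n x \<le> hinge_sum w n y"
  unfolding hinge_sum_def by (intro sum_mono mult_left_mono) (auto dest: incseq_SucD)

lemma hinge_sum_0 [simp]: "hinge_sum w n 0 = 0"
  by (simp add: hinge_sum_def)

lemma hinge_sum_measurable [measurable]: "hinge_sum w n \<in> borel_measurable borel"
  unfolding hinge_sum_def by measurable

text \<open>Up to \<open>N\<close> only the hinges with \<open>j < N\<close> are active, and their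
  slopes telescope to \<open>w N\<close> because \<open>w 0 = 0\<close>.\<close>

lemma hinge_sum_increase_le:
  assumes w: "mono w" "w 0 = 0" and "x \<le> y" "y \<le> real N"
  shows "hinge_sum w n y \<le> hinge_sum w n x + w N * (y - x)"
proof -
  have d: "w j \<le> w (Suc j)" for j using w by (simp add: monoD)
  have "hinge_sum w n y - hinge_sum w n x
      = (\<Sum>j<n. (w (Suc j) - w j) * (max 0 (y - real j) - max 0 (x - real j)))"
    unfolding hinge_sum_def by (simp add: sum_subtractf right_diff_distrib)
  also have "\<dots> \<le> (\<Sum>j<n. (w (Suc j) - w j) * (if j < N then y - x else 0))"
    using d assms by (intro sum_mono mult_left_mono) auto
  also have "\<dots> = (\<Sum>j\<in>{..<n} \<inter> {..<N}. (w (Suc j) - w j) * (y - x))"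
    by (intro sum.mono_neutral_cong_right) auto
  also have "\<dots> \<le> (\<Sum>j<N. (w (Suc j) - w j) * (y - x))"
    using d assms by (intro sum_mono2) auto
  also have "\<dots> = w N * (y - x)"
    using w by (simp add: sum_distrib_right[symmetric] sum_lessThan_telescope)
  finally show ?thesis by simp
qed

text \<open>Each of the hinges \<open>j < k\<close> still has height at least 1 at \<open>y\<close>,
  so it loses at least 1 on a unit step down; the slopes of these hinges telescope to
  \<open>w k\<close>. The bound \<open>k \<le> n\<close> ensures that all of them occur in the
  sum.\<close>

lemma hinge_sum_decrease_ge:
  assumes w: "mono w" "w 0 = 0" and "real k \<le> y" "x \<le> y - 1" "k \<le> n"
  shows "hinge_sum w n x \<le> hinge_sum w n y - w k"
proof -
  have d: "w j \<le> w (Suc j)" for j using w by (simp add: monoD)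
  have "w k = (\<Sum>j<k. w (Suc j) - w j)"
    using w by (simp add: sum_lessThan_telescope)
  also have "\<dots> = (\<Sum>j<n. (w (Suc j) - w j) * (if j < k then 1 else 0))"
    using assms by (intro sum.mono_neutral_cong_left) auto
  also have "\<dots> \<le> (\<Sum>j<n. (w (Suc j) - w j) * (max 0 (y - real j) - max 0 (x - real j)))"
    using d assms by (intro sum_mono mult_left_mono) auto
  also have "\<dots> = hinge_sum w n y - hinge_sum w n x"
    unfolding hinge_sum_def by (simp add: sum_subtractf right_diff_distrib)
  finally show ?thesis by simp
qed

section \<open>Level counts of two families of sizes and the potential built on them\<close>

definition surplus :: "'i set \<Rightarrow> ('i \<Rightarrow> real) \<Rightarrow> ('i \<Rightarrow> real) \<Rightarrow> real \<Rightarrow> real" where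
  "surplus X a b q = (\<Sum>i\<in>X. indicator {..a i} q - indicator {..b i} q)"

lemma surplus_measurable [measurable]: "surplus X a b \<in> borel_measurable borel"
  unfolding surplus_def by measurable

lemma surplus_le_card: "finite X \<Longrightarrow> surplus X a b q \<le> real (card X)"
  unfolding surplus_def
  by (rule order_trans[OF sum_bounded_above[of X _ 1]]) (auto split: split_indicator)

text \<open>\<open>surplus\<close> is the \<open>D\<close> of the overview, with \<open>a\<close>
  for the algorithm and \<open>b\<close> for the competitor. As it never exceeds
  \<open>card X\<close>, that many hinges suffice. Only positive levels count, so negative remaining
  sizes of overworked tasks are ignored; the cutoff \<open>B\<close> keeps the integral
  finite.\<close>

definition level_potential ::
  "(nat \<Rightarrow> real) \<Rightarrow> 'i set \<Rightarrow> real \<Rightarrow> ('i \<Rightarrow> real) \<Rightarrow> ('i \<Rightarrow> real) \<Rightarrow> real" where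
  "level_potential w X B a b = (LINT q:{0<..B}|lborel. hinge_sum w (card X) (surplus X a b q))"

lemma level_potential_integrable:
  assumes "finite X" "mono w"
  shows "set_integrable lborel {0<..B} (\<lambda>q. hinge_sum w (card X) (surplus X a b q))"
  unfolding set_integrable_def
proof (rule Bochner_Integration.integrable_bound)
  show "integrable lborel (\<lambda>q. indicator {0<..B} q *\<^sub>R hinge_sum w (card X) (card X) :: real)"
    by (intro integrable_scaleR_left integrable_real_indicator) (auto simp: emeasure_bounded_finite[unfolded infinity_ennreal_def])
  show "AE q in lborel. norm (indicator {0<..B} q *\<^sub>R hinge_sum w (card X) (surplus X a b q))
      \<le> norm (indicator {0<..B} q *\<^sub>R hinge_sum w (card X) (card X))"
    using assms hinge_sum_mono[OF assms(2) surplus_le_card[OF assms(1)]] hinge_sum_nonneg[OF assms(2)]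
    by (intro AE_I2) (auto split: split_indicator)
qed measurable

lemma level_potential_nonneg: "mono w \<Longrightarrow> 0 \<le> level_potential w X B a b"
  unfolding level_potential_def set_lebesgue_integral_def
  by (intro integral_nonneg_AE AE_I2) (auto simp: hinge_sum_nonneg)

lemma level_potential_eq_0: "(\<And>i. i \<in> X \<Longrightarrow> a i = b i) \<Longrightarrow> level_potential w X B a b = 0"
  by (simp add: level_potential_def surplus_def)

lemma interval_indicator_integrable:
  fixes B l u c :: real
  shows "set_integrable lborel {0<..B} (\<lambda>q. c * indicator {l<..u} q :: real)"
  unfolding set_integrable_def
  by (intro integrable_mult_indicator integrable_mult_right integrable_real_indicator)
     (auto simp: emeasure_bounded_finite[unfolded infinity_ennreal_def])

text \<open>Lowering \<open>b i\<close> to \<open>b' i\<close> raises the surplus by one exactly on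
  the levels in \<open>{b' i<..b i}\<close>. The surplus stays below \<open>N\<close>, so each such
  level costs at most \<open>w N\<close> per unit; restricting to \<open>{0<..B}\<close> can only
  shorten the intervals.\<close>

lemma level_potential_lower_second:
  assumes X: "finite X" and w: "mono w" "w 0 = 0"
    and b: "\<And>i. i \<in> X \<Longrightarrow> b' i \<le> b i"
    and N: "\<And>q. 0 < q \<Longrightarrow> surplus X a b' q \<le> real N"
  shows "level_potential w X B a b' \<le> level_potential w X B a b + w N * (\<Sum>i\<in>X. b i - b' i)"
proof -
  let ?h = "\<lambda>q. \<Sum>i\<in>X. w N * indicator {b' i<..b i} q :: real"
  have wN: "0 \<le> w N" using w monoD[of w 0 N] by simp
  have int_h: "set_integrable lborel {0<..B} ?h"
    unfolding set_integrable_def scaleR_sum_right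
    by (intro Bochner_Integration.integrable_sum interval_indicator_integrable[unfolded set_integrable_def])
  have pt: "hinge_sum w (card X) (surplus X a b' q) \<le> hinge_sum w (card X) (surplus X a b q) + ?h q"
    if "q \<in> {0<..B}" for q
  proof -
    have diff: "surplus X a b' q - surplus X a b q = (\<Sum>i\<in>X. indicator {b' i<..b i} q)"
      unfolding surplus_def sum_subtractf[symmetric]
      using b by (intro sum.cong) (force split: split_indicator)+
    moreover have "0 \<le> (\<Sum>i\<in>X. indicator {b' i<..b i} q :: real)"
      by (intro sum_nonneg) simp
    ultimately have "surplus X a b q \<le> surplus X a b' q" by linarith
    from hinge_sum_increase_le[OF w this N] that diff show ?thesis
      by (simp add: sum_distrib_left)
  qed
  have "level_potential w X B a b' \<le>
      (LINT q:{0<..B}|lborel. hinge_sum w (card X) (surplus X a b q) + ?h q)"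
    unfolding level_potential_def using X w int_h pt
    by (intro set_integral_mono set_integral_add level_potential_integrable) auto
  also have "\<dots> = level_potential w X B a b + (LINT q:{0<..B}|lborel. ?h q)"
    unfolding level_potential_def using X w int_h
    by (intro set_integral_add level_potential_integrable)
  also have "(LINT q:{0<..B}|lborel. ?h q) = (\<Sum>i\<in>X. LINT q:{0<..B}|lborel. w N * indicator {b' i<..b i} q)"
    unfolding set_lebesgue_integral_def scaleR_sum_right
    by (intro Bochner_Integration.integral_sum interval_indicator_integrable[unfolded set_integrable_def])
  also have "\<dots> \<le> (\<Sum>i\<in>X. w N * (b i - b' i))"
  proof (rule sum_mono)
    fix i assume i: "i \<in> X"
    have "(LINT q:{0<..B}|lborel. w N * indicator {b' i<..b i} q) \<le> (LINT q|lborel. w N * indicator {b' i<..b i} q)"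
      unfolding set_lebesgue_integral_def
      using interval_indicator_integrable[of B "w N" "b' i" "b i"] wN
      by (intro integral_mono integrable_mult_right integrable_real_indicator)
         (auto simp: set_integrable_def emeasure_bounded_finite[unfolded infinity_ennreal_def] split: split_indicator)
    also have "\<dots> = w N * (b i - b' i)"
      using b[OF i] by simp
    finally show "(LINT q:{0<..B}|lborel. w N * indicator {b' i<..b i} q) \<le> w N * (b i - b' i)" .
  qed
  finally show ?thesis by (simp add: sum_distrib_left)
qed

text \<open>On the levels in \<open>{a x - d<..a x}\<close> the surplus drops by at least one from a
  value of at least \<open>k\<close>, which saves \<open>w k\<close>; elsewhere it does not rise.
  The conditions on \<open>d\<close> and \<open>B\<close> place this whole interval, of length
  \<open>d\<close>, inside \<open>{0<..B}\<close>.\<close>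

lemma level_potential_lower_first:
  assumes X: "finite X" and w: "mono w" "w 0 = 0"
    and a: "\<And>i. i \<in> X \<Longrightarrow> a' i \<le> a i"
    and x: "x \<in> X" "a' x \<le> a x - d" "0 \<le> d" "d \<le> a x" "a x \<le> B"
    and k: "\<And>q. 0 < q \<Longrightarrow> q \<le> a x \<Longrightarrow> real k \<le> surplus X a b q"
  shows "level_potential w X B a' b \<le> level_potential w X B a b - w k * d"
proof -
  let ?h = "\<lambda>q. w k * indicator {a x - d<..a x} q :: real"
  have pt: "hinge_sum w (card X) (surplus X a' b q) \<le> hinge_sum w (card X) (surplus X a b q) - ?h q"
    if "q \<in> {0<..B}" for q
  proof -
    have diff: "surplus X a b q - surplus X a' b q = (\<Sum>i\<in>X. indicator {a' i<..a i} q)"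
      unfolding surplus_def sum_subtractf[symmetric]
      using a by (intro sum.cong) (force split: split_indicator)+
    show ?thesis
    proof (cases "q \<in> {a x - d<..a x}")
      case True
      have "1 \<le> (\<Sum>i\<in>X. indicator {a' i<..a i} q :: real)"
        using x True X by (intro order_trans[OF _ member_le_sum[of x]]) auto
      then have "surplus X a' b q \<le> surplus X a b q - 1" using diff by simp
      moreover have "real k \<le> surplus X a b q" using k True that by auto
      moreover from this have "k \<le> card X" using surplus_le_card[OF X, of a b q] by simp
      ultimately show ?thesis using hinge_sum_decrease_ge[OF w] True by simp
    next
      case False
      have "0 \<le> (\<Sum>i\<in>X. indicator {a' i<..a i} q :: real)"
        by (intro sum_nonneg) simp
      then show ?thesis using False diff hinge_sum_mono[OF w(1)] by simp
    qed
  qed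
  have "level_potential w X B a' b \<le>
      (LINT q:{0<..B}|lborel. hinge_sum w (card X) (surplus X a b q) - ?h q)"
    unfolding level_potential_def using X w pt
    by (intro set_integral_mono set_integral_diff level_potential_integrable interval_indicator_integrable) auto
  also have "\<dots> = level_potential w X B a b - (LINT q:{0<..B}|lborel. ?h q)"
    unfolding level_potential_def using X w
    by (intro set_integral_diff level_potential_integrable interval_indicator_integrable)
  also have "(LINT q:{0<..B}|lborel. ?h q) = (LINT q|lborel. w k * indicator {a x - d<..a x} q)"
    unfolding set_lebesgue_integral_def
    using x by (intro Bochner_Integration.integral_cong) (auto split: split_indicator)
  also have "\<dots> = w k * d" using x by simp
  finally show ?thesis .
qed

lemma level_potential_mono_first:
  assumes X: "finite X" and w: "mono w" and a: "\<And>i. i \<in> X \<Longrightarrow> a' i \<le> a i"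
  shows "level_potential w X B a' b \<le> level_potential w X B a b"
proof -
  have "surplus X a' b q \<le> surplus X a b q" for q
    unfolding surplus_def using a by (intro sum_mono diff_right_mono) (force split: split_indicator)
  then show ?thesis
    unfolding level_potential_def using X w
    by (intro set_integral_mono level_potential_integrable hinge_sum_mono) auto
qed

text \<open>A crude bound valid over any time span, with \<open>card X\<close> as the bound on the
  surplus. It supplies the absolutely continuous majorant that the almost everywhere argument
  requires.\<close>

lemma level_potential_increase_le:
  assumes "finite X" "mono w" "w 0 = 0" "\<And>i. i \<in> X \<Longrightarrow> a' i \<le> a i" "\<And>i. i \<in> X \<Longrightarrow> b' i \<le> b i"
  shows "level_potential w X D a' b' - level_potential w X D a b \<le> w (card X) * (\<Sum>i\<in>X. b i - b' i)"
  using level_potential_mono_first[of X w a' a D b'] level_potential_lower_second[of X w b' b a "card X" D]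
    surplus_le_card[of X] assms by fastforce

lemma level_potential_drift:
  fixes a b :: "real \<Rightarrow> 'i \<Rightarrow> real"
  assumes X: "finite X" and w: "mono w" "w 0 = 0"
    and anti_a: "\<And>i u. i \<in> X \<Longrightarrow> t \<le> u \<Longrightarrow> a u i \<le> a t i"
    and anti_b: "\<And>i u. i \<in> X \<Longrightarrow> t \<le> u \<Longrightarrow> b u i \<le> b t i"
    and R: "R \<subseteq> X"
    and unrel: "eventually (\<lambda>u. \<forall>i\<in>X - R. b u i = a t i) (at_right t)"
    and N: "card {i\<in>R. 0 < a t i} \<le> N"
    and rate_b: "\<And>e. e > 0 \<Longrightarrow> eventually (\<lambda>u. (\<Sum>i\<in>X. b t i - b u i) \<le> (u - t) * (v + e)) (at_right t)"
    and \<mu>: "0 \<le> \<mu>"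
    and rate_a: "k > 0 \<Longrightarrow> x \<in> X \<and> 0 < a t x \<and> a t x \<le> B \<and>
        k + card {i\<in>R. 0 < b t i} \<le> card {i\<in>R. a t x \<le> a t i}"
      "\<And>e. k > 0 \<Longrightarrow> e > 0 \<Longrightarrow> eventually (\<lambda>u. a u x \<le> a t x - (u - t) * (\<mu> - e)) (at_right t)"
    and e: "e > 0"
  shows "eventually (\<lambda>u. level_potential w X B (a u) (b u)
      \<le> level_potential w X B (a t) (b t) + (u - t) * (w N * v - w k * \<mu> + e)) (at_right t)"
proof -
  have w0: "0 \<le> w j" for j using w monoD[of w 0 j] by simp
  have finR: "finite R" using X R finite_subset by blast
  \<comment> \<open>Chosen so that the errors of the two moves, weighted by \<open>w N\<close> and
    \<open>w k\<close>, add up to at most \<open>e\<close>.\<close>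
  define e' where "e' = e / (w N + w k + 1)"
  have e': "e' > 0" using e w0[of N] w0[of k] by (simp add: e'_def)
  have "(w N + w k) * e' \<le> (w N + w k + 1) * e'" using e' by (intro mult_right_mono) auto
  also have "\<dots> = e" using w0[of N] w0[of k] by (simp add: e'_def add_nonneg_pos order.strict_implies_not_eq[symmetric])
  finally have ee: "w N * e' + w k * e' \<le> e" by (simp add: algebra_simps)
  have split: "surplus X (a t) (b u) q = (\<Sum>i\<in>R. indicator {..a t i} q) - (\<Sum>i\<in>R. indicator {..b u i} q)"
    if "\<forall>i\<in>X - R. b u i = a t i" for u q
  proof -
    have "surplus X (a t) (b u) q = (\<Sum>i\<in>R. indicator {..a t i} q - indicator {..b u i} q)"
      unfolding surplus_def using that R X by (intro sum.mono_neutral_right) auto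
    then show ?thesis by (simp add: sum_subtractf)
  qed
  have sum_card: "(\<Sum>i\<in>R. indicator {..c i} q) = real (card {i\<in>R. q \<le> c i})" for c :: "'i \<Rightarrow> real" and q
    using finR by (simp add: indicator_def of_bool_def sum.If_cases Int_def atMost_def)
  have upper: "surplus X (a t) (b u) q \<le> real N" if "\<forall>i\<in>X - R. b u i = a t i" "0 < q" for u q
  proof -
    have "card {i\<in>R. q \<le> a t i} \<le> card {i\<in>R. 0 < a t i}"
      using that finR by (intro card_mono) auto
    then show ?thesis using N that(1) by (simp add: split sum_card)
  qed
  have lower: "real k \<le> surplus X (a t) (b u) q"
    if "\<forall>i\<in>X - R. b u i = a t i" "0 < q" "q \<le> a t x" "t \<le> u" "k > 0" for u q
  proof -
    have "card {i\<in>R. a t x \<le> a t i} \<le> card {i\<in>R. q \<le> a t i}"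
      using that finR by (intro card_mono) auto
    moreover have "card {i\<in>R. q \<le> b u i} \<le> card {i\<in>R. 0 < b t i}"
      using that finR R anti_b by (intro card_mono) (auto, smt (verit) subsetD)
    ultimately show ?thesis using rate_a(1)[OF that(5)] that(1)
      by (simp add: split sum_card)
  qed
  have ev_gt: "eventually (\<lambda>u. t < u) (at_right t)"
    by (rule eventually_at_right_less)
  have ev_b: "eventually (\<lambda>u. level_potential w X B (a t) (b u)
      \<le> level_potential w X B (a t) (b t) + w N * ((u - t) * (v + e'))) (at_right t)"
    using unrel rate_b[OF e'] ev_gt
  proof eventually_elim
    case (elim u)
    have "level_potential w X B (a t) (b u) \<le> level_potential w X B (a t) (b t) + w N * (\<Sum>i\<in>X. b t i - b u i)"
      using elim anti_b upper by (intro level_potential_lower_second X w) auto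
    also have "\<dots> \<le> level_potential w X B (a t) (b t) + w N * ((u - t) * (v + e'))"
      using elim w0 by (intro add_left_mono mult_left_mono) auto
    finally show ?case .
  qed
  have ev_a: "eventually (\<lambda>u. level_potential w X B (a u) (b u)
      \<le> level_potential w X B (a t) (b u) - w k * ((u - t) * (\<mu> - e'))) (at_right t)"
  proof (cases "k > 0")
    case False
    then show ?thesis
      using ev_gt X w anti_a
      by (auto elim!: eventually_mono intro!: level_potential_mono_first)
  next
    case True
    note xk = rate_a(1)[OF True]
    \<comment> \<open>In a time window of this length the guaranteed progress cannot exceed
      \<open>a t x\<close>, so the processed levels stay positive. The maximum with 0 in
      \<open>d\<close> below covers the case \<open>\<mu> < e'\<close>.\<close>
    have "0 < a t x / (\<mu> + 1)" using xk \<mu> by simp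
    then have "eventually (\<lambda>u. u < t + a t x / (\<mu> + 1)) (at_right t)"
      unfolding eventually_at_right_field by (intro exI[of _ "t + a t x / (\<mu> + 1)"]) auto
    with unrel rate_a(2)[OF True e'] ev_gt show ?thesis
    proof eventually_elim
      case (elim u)
      define d where "d = max 0 ((u - t) * (\<mu> - e'))"
      have "(u - t) * (\<mu> - e') \<le> (u - t) * (\<mu> + 1)"
        using elim e' by (intro mult_left_mono) auto
      also have "\<dots> \<le> a t x" using elim \<mu> by (simp add: field_simps)
      finally have "d \<le> a t x" using xk by (simp add: d_def)
      moreover have "a u x \<le> a t x - d" using elim anti_a[of x u] xk by (auto simp: d_def max_def)
      ultimately have "level_potential w X B (a u) (b u) \<le> level_potential w X B (a t) (b u) - w k * d"
        using elim xk anti_a lower True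
        by (intro level_potential_lower_first[where x = x] X w) (auto simp: d_def)
      also have "\<dots> \<le> level_potential w X B (a t) (b u) - w k * ((u - t) * (\<mu> - e'))"
        using w0 by (intro diff_left_mono mult_left_mono) (auto simp: d_def)
      finally show ?case .
    qed
  qed
  from ev_a ev_b ev_gt show ?thesis
  proof eventually_elim
    case (elim u)
    have "(u - t) * (w N * e' + w k * e') \<le> (u - t) * e"
      using ee elim by (intro mult_left_mono) auto
    then show ?case using elim by (simp add: algebra_simps)
  qed
qed

section \<open>Schedules of a MapReduce instance\<close>

lemma finite_tasks [simp]: "finite (tasks I)"
proof -
  have "tasks I = (\<lambda>(i, k). MapT i k) ` (SIGMA i:{..<njobs I}. {..<nmap I i})
      \<union> (\<lambda>(i, k). RedT i k) ` ({..<njobs I} \<times> {..<nred I})"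
    by (auto simp: tasks_def image_iff)
  then show ?thesis by simp
qed

lemma MapT_in_tasks [simp]: "MapT i k \<in> tasks I \<longleftrightarrow> i < njobs I \<and> k < nmap I i"
  and RedT_in_tasks [simp]: "RedT i k \<in> tasks I \<longleftrightarrow> i < njobs I \<and> k < nred I"
  by (auto simp: tasks_def)

lemma release_simps [simp]: "release I (MapT i k) = rel I i" "release I (RedT i k) = rel I i"
  by (auto simp: release_def)

lemma is_done_mono: "is_done I S x t \<Longrightarrow> t \<le> u \<Longrightarrow> is_done I S x u"
  unfolding is_done_def work_def
  by (erule order_trans) (intro nn_integral_mono mult_left_mono, auto split: split_indicator)

definition map_tasks :: "mrinst \<Rightarrow> task set" where
  "map_tasks I = {x \<in> tasks I. is_map x}"

definition reduce_tasks :: "mrinst \<Rightarrow> task set" where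
  "reduce_tasks I = {x \<in> tasks I. \<not> is_map x}"

text \<open>The truncation matters: a feasible schedule may keep processing a finished task, which makes
  its \<open>rem\<close> negative.\<close>

definition job_rem :: "mrinst \<Rightarrow> schedule \<Rightarrow> nat \<Rightarrow> real \<Rightarrow> real" where
  "job_rem I S i t = (\<Sum>k<nmap I i. max 0 (rem I S (MapT i k) t))"

lemma finite_map_tasks [simp]: "finite (map_tasks I)" and finite_reduce_tasks [simp]: "finite (reduce_tasks I)"
  by (auto simp: map_tasks_def reduce_tasks_def)

lemma sum_tasks_split: "(\<Sum>x\<in>tasks I. f x) = (\<Sum>x\<in>map_tasks I. f x) + (\<Sum>x\<in>reduce_tasks I. f x)"
proof -
  have "tasks I = map_tasks I \<union> reduce_tasks I" by (auto simp: map_tasks_def reduce_tasks_def)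
  moreover have "map_tasks I \<inter> reduce_tasks I = {}" by (auto simp: map_tasks_def reduce_tasks_def)
  ultimately show ?thesis by (simp add: sum.union_disjoint)
qed

lemma sum_map_tasks: "(\<Sum>x\<in>map_tasks I. f x) = (\<Sum>i<njobs I. \<Sum>k<nmap I i. f (MapT i k))"
proof -
  have "map_tasks I = (\<lambda>(i, k). MapT i k) ` (SIGMA i:{..<njobs I}. {..<nmap I i})"
    by (auto simp: map_tasks_def tasks_def image_iff)
  then have "(\<Sum>x\<in>map_tasks I. f x) = (\<Sum>p\<in>(SIGMA i:{..<njobs I}. {..<nmap I i}). f (MapT (fst p) (snd p)))"
    by (simp add: sum.reindex inj_on_def case_prod_beta)
  then show ?thesis by (simp add: sum.Sigma case_prod_beta)
qed

text \<open>A common frame for the algorithm and for the competitor. Finite work matters because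
  \<open>enn2real\<close> sends infinity to 0, which would make \<open>rem\<close> jump back to the
  full size.\<close>

locale mr_run =
  fixes I :: mrinst and S :: schedule
  assumes valid: "valid_instance I" and feas: "feasible I S"
    and work_finite: "\<And>x t. x \<in> tasks I \<Longrightarrow> work S x t < \<infinity>"
begin

lemma S_measurable [measurable]: "S x \<in> borel_measurable borel"
  and S_nonneg: "0 \<le> S x t"
  and S_before_release: "t < release I x \<Longrightarrow> S x t = 0"
  and S_reduce: "S (RedT i k) t \<noteq> 0 \<Longrightarrow> k' < nmap I i \<Longrightarrow> is_done I S (MapT i k') t"
  using feas by (auto simp: feasible_def)

lemma size_pos: "x \<in> tasks I \<Longrightarrow> 0 < tsize I x"
  using valid by (simp add: valid_instance_def)

lemma work_eq: "work S x t = (\<integral>\<^sup>+u. ennreal (indicator {..t} u * S x u) \<partial>lborel)"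
  unfolding work_def by (intro nn_integral_cong) (auto split: split_indicator)

lemma S_integrable_atMost:
  assumes "x \<in> tasks I" shows "set_integrable lborel {..t} (S x)"
  unfolding set_integrable_def
  using work_finite[OF assms, of t] S_nonneg
  by (intro integrableI_nonneg) (auto simp: work_eq)

lemma S_integrable_Icc:
  assumes "x \<in> tasks I" shows "set_integrable lborel {t..u} (S x)"
  by (rule set_integrable_subset[OF S_integrable_atMost[OF assms, of u]]) auto

lemma S_integrable_on: "x \<in> tasks I \<Longrightarrow> S x integrable_on {t..u}"
  using set_borel_integral_eq_integral(1)[OF S_integrable_Icc] .

lemma enn2real_work: "x \<in> tasks I \<Longrightarrow> enn2real (work S x t) = (LINT u:{..t}|lborel. S x u)"
  unfolding work_eq set_lebesgue_integral_def
  using S_integrable_atMost[of x t] S_nonneg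
  by (subst nn_integral_eq_integral) (auto simp: set_integrable_def intro!: integral_nonneg_AE)

lemma rem_diff:
  assumes x: "x \<in> tasks I" and "t \<le> u"
  shows "rem I S x t - rem I S x u = integral {t..u} (S x)"
proof -
  have "{..u} = {..t} \<union> {t<..u}" using assms by auto
  moreover have "set_integrable lborel {t<..u} (S x)"
    by (rule set_integrable_subset[OF S_integrable_atMost[OF x, of u]]) auto
  moreover have "{..t} \<inter> {t<..u} = {}" by auto
  ultimately have "(LINT v:{..u}|lborel. S x v) = (LINT v:{..t}|lborel. S x v) + (LINT v:{t<..u}|lborel. S x v)"
    using S_integrable_atMost[OF x, of t] by (simp only: set_integral_Un)
  also have "(LINT v:{t<..u}|lborel. S x v) = integral {t<..u} (S x)"
    using \<open>set_integrable lborel {t<..u} (S x)\<close> by (rule set_borel_integral_eq_integral)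
  also have "\<dots> = integral {t..u} (S x)"
    by (intro integral_spike_set) (auto intro: negligible_subset[of "{t}"])
  finally show ?thesis by (simp add: rem_def enn2real_work[OF x])
qed

lemma rem_antimono: "x \<in> tasks I \<Longrightarrow> t \<le> u \<Longrightarrow> rem I S x u \<le> rem I S x t"
  using rem_diff[of x t u] S_integrable_on[of x t u] S_nonneg
    integral_nonneg[of "S x" "{t..u}"] by fastforce

lemma rem_le_size: "rem I S x t \<le> tsize I x"
  by (simp add: rem_def)

lemma rem_before_release: "t < release I x \<Longrightarrow> rem I S x t = tsize I x"
proof -
  assume "t < release I x"
  then have "work S x t = (\<integral>\<^sup>+u. 0 \<partial>(lborel :: real measure))"
    unfolding work_def by (intro nn_integral_cong) (auto simp: S_before_release split: split_indicator)
  then show ?thesis by (simp add: rem_def)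
qed

lemma is_done_iff:
  assumes "x \<in> tasks I" shows "is_done I S x t \<longleftrightarrow> rem I S x t \<le> 0"
proof -
  have "work S x t = ennreal (enn2real (work S x t))"
    using work_finite[OF assms, of t] by simp
  then show ?thesis
    unfolding is_done_def rem_def using size_pos[OF assms]
    by (metis diff_le_0_iff_le enn2real_nonneg ennreal_le_iff)
qed

section \<open>Unfinished tasks, active jobs and their remaining map work\<close>

lemma unfinished_iff: "unfinished I S x t \<longleftrightarrow> x \<in> tasks I \<and> release I x \<le> t \<and> 0 < rem I S x t"
  using is_done_iff[of x t] by (auto simp: unfinished_def)

lemma umaps_eq: "umaps I S t = {x \<in> {x \<in> map_tasks I. release I x \<le> t}. 0 < rem I S x t}"
  by (auto simp: umaps_def unfinished_iff map_tasks_def)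

lemma finite_unfinished [simp]: "finite {x. unfinished I S x t}"
  by (rule finite_subset[of _ "tasks I"]) (auto simp: unfinished_def)

lemma finite_umaps [simp]: "finite (umaps I S t)"
  by (simp add: umaps_eq)

lemma finite_freereds [simp]: "finite (freereds I S t)"
  by (rule finite_subset[of _ "{x. unfinished I S x t}"]) (auto simp: freereds_def)

lemma finite_ajobs [simp]: "finite (ajobs I S t)"
  by (simp add: ajobs_def)

lemma umaps_job:
  assumes "rel I i \<le> t" "i < njobs I"
  shows "{y \<in> umaps I S t. job y = i} = MapT i ` {k\<in>{..<nmap I i}. 0 < rem I S (MapT i k) t}"
  (is "?L = ?R")
proof
  show "?L \<subseteq> ?R"
  proof
    fix y assume "y \<in> ?L"
    then show "y \<in> ?R" by (cases y) (auto simp: umaps_eq map_tasks_def)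
  qed
qed (use assms in \<open>auto simp: umaps_eq map_tasks_def\<close>)

lemma cumrem_eq_job_rem:
  assumes "rel I i \<le> t" "i < njobs I"
  shows "cumrem I S i t = job_rem I S i t"
proof -
  have "cumrem I S i t = (\<Sum>k\<in>{k\<in>{..<nmap I i}. 0 < rem I S (MapT i k) t}. rem I S (MapT i k) t)"
    unfolding cumrem_def umaps_job[OF assms] by (simp add: sum.reindex inj_on_def)
  also have "\<dots> = job_rem I S i t"
    unfolding job_rem_def by (intro sum.mono_neutral_cong_left) auto
  finally show ?thesis .
qed

lemma ajobs_eq: "ajobs I S t = {i \<in> {i \<in> {..<njobs I}. rel I i \<le> t}. 0 < job_rem I S i t}"
proof (intro equalityI subsetI)
  fix i assume "i \<in> ajobs I S t"
  then obtain y where y: "y \<in> umaps I S t" "job y = i" by (auto simp: ajobs_def)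
  then obtain k where k: "y = MapT i k" "k < nmap I i" "i < njobs I" "rel I i \<le> t" "0 < rem I S (MapT i k) t"
    by (cases y) (auto simp: umaps_eq map_tasks_def)
  have "0 < job_rem I S i t"
    unfolding job_rem_def by (rule sum_pos2[of _ k]) (use k in auto)
  then show "i \<in> {i \<in> {i \<in> {..<njobs I}. rel I i \<le> t}. 0 < job_rem I S i t}" using k by simp
next
  fix i assume i: "i \<in> {i \<in> {i \<in> {..<njobs I}. rel I i \<le> t}. 0 < job_rem I S i t}"
  have "\<exists>k<nmap I i. 0 < rem I S (MapT i k) t"
  proof (rule ccontr)
    assume "\<not> ?thesis"
    then have "job_rem I S i t = 0" unfolding job_rem_def by (intro sum.neutral) (auto simp: max_def)
    then show False using i by simp
  qed
  then show "i \<in> ajobs I S t" using i by (force simp: ajobs_def umaps_eq map_tasks_def image_iff)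
qed

lemma job_rem_antimono: "i < njobs I \<Longrightarrow> t \<le> u \<Longrightarrow> job_rem I S i u \<le> job_rem I S i t"
  unfolding job_rem_def using rem_antimono by (intro sum_mono max.mono) auto

text \<open>Truncation at 0 does not increase differences. Hence the job sizes of a schedule shrink
  no faster in total than its map speed allows.\<close>

lemma job_rem_decrease_le:
  assumes "t \<le> u"
  shows "(\<Sum>i<njobs I. job_rem I S i t - job_rem I S i u) \<le> (\<Sum>x\<in>map_tasks I. rem I S x t - rem I S x u)"
  unfolding sum_map_tasks job_rem_def sum_subtractf[symmetric]
proof (intro sum_mono)
  fix i k assume "i \<in> {..<njobs I}" "k \<in> {..<nmap I i}"
  then show "max 0 (rem I S (MapT i k) t) - max 0 (rem I S (MapT i k) u)
      \<le> rem I S (MapT i k) t - rem I S (MapT i k) u"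
    using rem_antimono[of "MapT i k" t u] assms by simp
qed

text \<open>As long as the task does not fall below 0, truncation hides none of its progress, and
  the other map tasks of the job can only shrink.\<close>

lemma job_rem_decrease_ge:
  assumes "t \<le> u" "i < njobs I" "k < nmap I i" "0 < rem I S (MapT i k) t" "0 \<le> rem I S (MapT i k) u"
  shows "job_rem I S i u \<le> job_rem I S i t - (rem I S (MapT i k) t - rem I S (MapT i k) u)"
proof -
  have "(\<Sum>k'<nmap I i. if k' = k then rem I S (MapT i k) t - rem I S (MapT i k) u else 0)
      \<le> job_rem I S i t - job_rem I S i u"
    unfolding job_rem_def sum_subtractf[symmetric]
  proof (rule sum_mono)
    fix k' assume "k' \<in> {..<nmap I i}"
    then show "(if k' = k then rem I S (MapT i k) t - rem I S (MapT i k) u else 0)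
        \<le> max 0 (rem I S (MapT i k') t) - max 0 (rem I S (MapT i k') u)"
      using assms rem_antimono[of "MapT i k'" t u] by auto
  qed
  then show ?thesis using assms by simp
qed

text \<open>Completion persists, so a map task unfinished at \<open>t\<close> was unfinished at all
  earlier times. Feasibility then forbids any earlier processing of the reduce task, which still has
  its full positive size.\<close>

lemma reduce_unfinished_of_ajob:
  assumes "i \<in> ajobs I S t" "k < nred I"
  shows "unfinished I S (RedT i k) t"
proof -
  obtain k' where k': "k' < nmap I i" "i < njobs I" "rel I i \<le> t" "0 < rem I S (MapT i k') t"
    using assms(1) unfolding ajobs_def umaps_eq map_tasks_def
    by (auto simp: tasks_def)
  have "S (RedT i k) u = 0" if "u \<le> t" for u
  proof (rule ccontr)
    assume "S (RedT i k) u \<noteq> 0"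
    then have "is_done I S (MapT i k') t" using S_reduce k' that is_done_mono by blast
    then show False using k' by (simp add: is_done_iff)
  qed
  then have "work S (RedT i k) t = (\<integral>\<^sup>+u. 0 \<partial>(lborel :: real measure))"
    unfolding work_def by (intro nn_integral_cong) (auto split: split_indicator)
  then have "rem I S (RedT i k) t = tsize I (RedT i k)" unfolding rem_def by simp
  then show ?thesis using k' assms size_pos[of "RedT i k"] by (simp add: unfinished_iff)
qed

text \<open>A reduce task is either free or blocked by its job's map phase. By the preceding lemma
  each active job blocks all of its \<open>nred I\<close> reduce tasks, which is why the number of
  active jobs determines the number of blocked tasks.\<close>

lemma card_unfinished_reduce:
  "card {x \<in> {x \<in> reduce_tasks I. release I x \<le> t}. 0 < rem I S x t}
    = card (freereds I S t) + nred I * card (ajobs I S t)"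
proof -
  let ?B = "(\<lambda>(i, k). RedT i k) ` (ajobs I S t \<times> {..<nred I})"
  have "{x \<in> {x \<in> reduce_tasks I. release I x \<le> t}. 0 < rem I S x t} = freereds I S t \<union> ?B" (is "?L = _")
  proof (intro equalityI subsetI)
    fix x assume x: "x \<in> ?L"
    then obtain i k where ik: "x = RedT i k" by (cases x) (auto simp: reduce_tasks_def)
    with x have u: "unfinished I S x t" "i < njobs I" "k < nred I" "rel I i \<le> t"
      by (auto simp: reduce_tasks_def unfinished_iff)
    show "x \<in> freereds I S t \<union> ?B"
    proof (cases "\<forall>k < nmap I i. is_done I S (MapT i k) t")
      case True
      then show ?thesis using u ik by (auto simp: freereds_def)
    next
      case False
      then obtain k' where "k' < nmap I i" "0 < rem I S (MapT i k') t"
        using u by (auto simp: is_done_iff)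
      then have "i \<in> ajobs I S t"
        using u by (force simp: ajobs_def umaps_eq map_tasks_def image_iff)
      then show ?thesis using u ik by auto
    qed
  next
    fix x assume "x \<in> freereds I S t \<union> ?B"
    then have "unfinished I S x t \<and> \<not> is_map x"
      using reduce_unfinished_of_ajob by (auto simp: freereds_def)
    then show "x \<in> ?L" by (auto simp: unfinished_iff reduce_tasks_def)
  qed
  moreover have "freereds I S t \<inter> ?B = {}"
  proof -
    have False if i: "i \<in> ajobs I S t" and f: "RedT i k \<in> freereds I S t" for i k
    proof -
      obtain y where "y \<in> umaps I S t" "job y = i" using i by (auto simp: ajobs_def)
      then obtain k' where "k' < nmap I i" "\<not> is_done I S (MapT i k') t"
        by (cases y) (auto simp: umaps_def unfinished_def)
      then show False using f by (simp add: freereds_def)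
    qed
    then show ?thesis by auto
  qed
  moreover have "card ?B = nred I * card (ajobs I S t)"
    by (subst card_image) (auto simp: inj_on_def)
  ultimately show ?thesis by (simp add: card_Un_disjoint)
qed

lemma card_unfinished:
  "card {x. unfinished I S x t} = card (umaps I S t) + card (freereds I S t) + nred I * card (ajobs I S t)"
proof -
  let ?R = "{x \<in> {x \<in> reduce_tasks I. release I x \<le> t}. 0 < rem I S x t}"
  have "{x. unfinished I S x t} = umaps I S t \<union> ?R" "umaps I S t \<inter> ?R = {}"
    by (auto simp: unfinished_iff umaps_eq map_tasks_def reduce_tasks_def)
  then show ?thesis using card_unfinished_reduce[of t] by (simp add: card_Un_disjoint)
qed

text \<open>The count is a finite sum of indicators of half-lines, in which \<open>rem\<close> is
  measurable because it is monotone in time.\<close>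

lemma card_unfinished_measurable [measurable]:
  "(\<lambda>t. real (card {x. unfinished I S x t})) \<in> borel_measurable borel"
proof -
  have eq: "real (card {x. unfinished I S x t})
      = (\<Sum>x\<in>tasks I. indicator {release I x..} t * indicator {0<..} (rem I S x t))" for t
  proof -
    have "(\<Sum>x\<in>tasks I. indicator {release I x..} t * indicator {0<..} (rem I S x t))
        = (\<Sum>x\<in>tasks I. if unfinished I S x t then 1 else 0 :: real)"
      by (intro sum.cong) (auto simp: unfinished_iff split: split_indicator)
    also have "\<dots> = real (card {x\<in>tasks I. unfinished I S x t})"
      by (simp add: sum.If_cases Int_def)
    also have "{x\<in>tasks I. unfinished I S x t} = {x. unfinished I S x t}"
      by (auto simp: unfinished_def)
    finally show ?thesis by simp
  qed
  have [measurable]: "rem I S x \<in> borel_measurable borel" if "x \<in> tasks I" for x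
  proof -
    have "mono (\<lambda>t. - rem I S x t)" using rem_antimono[OF that] by (auto intro: monoI)
    then have "(\<lambda>t. - rem I S x t) \<in> borel_measurable borel" by (rule borel_measurable_mono)
    then have "(\<lambda>t. - (- rem I S x t)) \<in> borel_measurable borel" by (rule borel_measurable_uminus)
    then show ?thesis by simp
  qed
  show ?thesis unfolding eq by measurable
qed

section \<open>Times that are right Lebesgue points of all processing rates at once\<close>

definition regular_time :: "real \<Rightarrow> bool" where
  "regular_time t \<longleftrightarrow> (\<forall>x\<in>tasks I. \<forall>e>0.
     eventually (\<lambda>u. \<bar>integral {t..u} (S x) - (u - t) * S x t\<bar> \<le> e * (u - t)) (at_right t))"

lemma AE_regular_time: "AE t in lborel. regular_time t"
  unfolding regular_time_def
  by (subst AE_finite_all) (auto intro!: AE_right_derivative_integral S_integrable_on)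

lemma regular_rem_sum:
  assumes "regular_time t" "A \<subseteq> tasks I" "e > 0"
  shows "eventually (\<lambda>u. (\<Sum>x\<in>A. rem I S x t - rem I S x u) \<le> (u - t) * ((\<Sum>x\<in>A. S x t) + e)) (at_right t)"
proof -
  have finA: "finite A" using assms(2) by (rule finite_subset) simp
  define e' where "e' = e / (real (card A) + 1)"
  have e': "e' > 0" using assms by (simp add: e'_def)
  have "real (card A) * e' \<le> (real (card A) + 1) * e'" using e' by (intro mult_right_mono) auto
  also have "\<dots> = e" by (simp add: e'_def)
  finally have ce: "real (card A) * e' \<le> e" .
  have "\<forall>\<^sub>F u in at_right t. \<forall>x\<in>A. \<bar>integral {t..u} (S x) - (u - t) * S x t\<bar> \<le> e' * (u - t)"
    using assms e' finA by (intro eventually_ball_finite) (auto simp: regular_time_def)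
  moreover have "eventually (\<lambda>u. t < u) (at_right t)"
    by (rule eventually_at_right_less)
  ultimately show ?thesis
  proof eventually_elim
    case (elim u)
    have "(\<Sum>x\<in>A. rem I S x t - rem I S x u) \<le> (\<Sum>x\<in>A. (u - t) * S x t + e' * (u - t))"
    proof (rule sum_mono)
      fix x assume x: "x \<in> A"
      then have "rem I S x t - rem I S x u = integral {t..u} (S x)"
        using assms elim by (intro rem_diff) auto
      then show "rem I S x t - rem I S x u \<le> (u - t) * S x t + e' * (u - t)"
        using elim x by (fastforce simp: abs_le_iff)
    qed
    also have "\<dots> = (u - t) * (\<Sum>x\<in>A. S x t) + (u - t) * (real (card A) * e')"
      by (simp add: sum.distrib sum_distrib_left)
    also have "\<dots> \<le> (u - t) * (\<Sum>x\<in>A. S x t) + (u - t) * e"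
      using elim ce by (intro add_left_mono mult_left_mono) auto
    finally show ?case by (simp add: distrib_left)
  qed
qed

lemma regular_rem:
  assumes "regular_time t" "x \<in> tasks I" "e > 0" "\<mu> \<le> S x t"
  shows "eventually (\<lambda>u. rem I S x u \<le> rem I S x t - (u - t) * (\<mu> - e)) (at_right t)"
proof -
  have "eventually (\<lambda>u. \<bar>integral {t..u} (S x) - (u - t) * S x t\<bar> \<le> e * (u - t)) (at_right t)"
    using assms by (simp add: regular_time_def)
  moreover have "eventually (\<lambda>u. t < u) (at_right t)"
    by (rule eventually_at_right_less)
  ultimately show ?thesis
  proof eventually_elim
    case (elim u)
    have "(u - t) * \<mu> \<le> (u - t) * S x t" using elim assms by (intro mult_left_mono) auto
    moreover have "rem I S x t - rem I S x u = integral {t..u} (S x)"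
      using assms elim by (intro rem_diff) auto
    ultimately show ?case using elim by (simp add: abs_le_iff algebra_simps)
  qed
qed

text \<open>The loss is at most \<open>(u - t) * (S x t + 1)\<close> just after \<open>t\<close>, so
  a positive remainder survives for a short while. This supplies the sign condition of
  \<open>job_rem_decrease_ge\<close>.\<close>

lemma regular_rem_pos:
  assumes "regular_time t" "x \<in> tasks I" "0 < rem I S x t"
  shows "eventually (\<lambda>u. 0 \<le> rem I S x u) (at_right t)"
proof -
  have "eventually (\<lambda>u. rem I S x t - rem I S x u \<le> (u - t) * (S x t + 1)) (at_right t)"
    using regular_rem_sum[OF assms(1), of "{x}" 1] assms by simp
  moreover have "eventually (\<lambda>u. t < u \<and> u < t + rem I S x t / (S x t + 1)) (at_right t)"
    unfolding eventually_at_right_field using assms S_nonneg[of x t]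
    by (intro exI[of _ "t + rem I S x t / (S x t + 1)"]) (auto simp: add_nonneg_pos)
  ultimately show ?thesis
  proof eventually_elim
    case (elim u)
    have "(u - t) * (S x t + 1) \<le> rem I S x t"
      using elim S_nonneg[of x t] pos_less_divide_eq[of "S x t + 1" "u - t" "rem I S x t"] by simp
    then show ?case using elim by simp
  qed
qed

lemma regular_job_rem:
  assumes "regular_time t" "i < njobs I" "k < nmap I i" "0 < rem I S (MapT i k) t" "e > 0" "\<mu> \<le> S (MapT i k) t"
  shows "eventually (\<lambda>u. job_rem I S i u \<le> job_rem I S i t - (u - t) * (\<mu> - e)) (at_right t)"
proof -
  have "eventually (\<lambda>u. t < u) (at_right t)"
    by (rule eventually_at_right_less)
  with regular_rem[OF assms(1) _ assms(5,6)] regular_rem_pos[OF assms(1) _ assms(4)] assms(2,3)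
  have "\<forall>\<^sub>F u in at_right t. t < u \<and> 0 \<le> rem I S (MapT i k) u \<and>
      rem I S (MapT i k) u \<le> rem I S (MapT i k) t - (u - t) * (\<mu> - e)"
    by (simp add: eventually_conj)
  then show ?thesis
  proof eventually_elim
    case (elim u)
    then show ?case using job_rem_decrease_ge[of t u i k] assms by auto
  qed
qed

end

section \<open>Weights, speeds and the algorithm\<close>

definition weight :: "real \<Rightarrow> real \<Rightarrow> nat \<Rightarrow> real" where
  "weight \<alpha> c k = \<alpha> * (c * real k) powr (1 - 1 / \<alpha>)"

lemma weight_0 [simp]: "weight \<alpha> c 0 = 0"
  by (simp add: weight_def)

lemma mono_weight: "1 < \<alpha> \<Longrightarrow> 0 \<le> c \<Longrightarrow> mono (weight \<alpha> c)"
  unfolding weight_def by (intro monoI mult_left_mono powr_mono2) auto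

lemma weight_nonneg: "1 < \<alpha> \<Longrightarrow> 0 \<le> weight \<alpha> c k"
  by (simp add: weight_def)

text \<open>Young's inequality with exponents \<alpha> and \<open>\<alpha> / (\<alpha> - 1)\<close>,
  multiplied by \<alpha>. It splits the effect of the competitor's speed into its own power and a
  multiple of the algorithm's backlog \<open>z\<close>.\<close>

lemma Youngs_inequality_power:
  fixes \<alpha> s z :: real
  assumes "1 < \<alpha>" "0 \<le> s" "0 \<le> z"
  shows "\<alpha> * z powr (1 - 1 / \<alpha>) * s \<le> s powr \<alpha> + (\<alpha> - 1) * z"
proof -
  define q where "q = \<alpha> / (\<alpha> - 1)"
  have q: "q > 1" "1 / \<alpha> + 1 / q = 1" "1 - 1 / \<alpha> = 1 / q"
    using assms by (auto simp: q_def field_simps)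
  have "s * z powr (1 / q) \<le> s powr \<alpha> / \<alpha> + (z powr (1 / q)) powr q / q"
    using assms q by (intro Youngs_inequality) auto
  also have "(z powr (1 / q)) powr q = z"
    using q assms by (simp add: powr_powr)
  finally have "\<alpha> * (s * z powr (1 / q)) \<le> \<alpha> * (s powr \<alpha> / \<alpha> + z / q)"
    using assms by (intro mult_left_mono) auto
  also have "\<dots> = s powr \<alpha> + (\<alpha> - 1) * z"
    using assms by (simp add: q_def field_simps)
  finally show ?thesis by (simp add: q mult_ac)
qed

text \<open>\<open>c\<close> is the number of tasks that one item stands for: 1 for a single task,
  \<open>nred I\<close> for a job with its blocked reduce tasks.\<close>

lemma weight_speed_le:
  assumes "1 < \<alpha>" "0 \<le> s" "0 \<le> c"
  shows "weight \<alpha> c N * s \<le> s powr \<alpha> + (\<alpha> - 1) * (c * real N)"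
  unfolding weight_def using assms by (intro Youngs_inequality_power) auto

text \<open>The product of the powers \<open>1 - 1 / \<alpha>\<close> and
  \<open>1 / \<alpha>\<close> of \<open>c * real k\<close> is \<open>c * real k\<close> itself, and
  the prescribed speed is at least the second factor.\<close>

lemma weight_speed_ge:
  assumes "1 < \<alpha>" "0 \<le> c" "c * real k \<le> z"
  shows "\<alpha> * (c * real k) \<le> weight \<alpha> c k * (z + 1) powr (1 / \<alpha>)"
proof -
  have "c * real k = (c * real k) powr (1 - 1 / \<alpha>) * (c * real k) powr (1 / \<alpha>)"
    using assms by (simp add: powr_add[symmetric])
  also have "\<dots> \<le> (c * real k) powr (1 - 1 / \<alpha>) * (z + 1) powr (1 / \<alpha>)"
    using assms by (intro mult_left_mono powr_mono2) auto
  finally have "\<alpha> * (c * real k) \<le> \<alpha> * ((c * real k) powr (1 - 1 / \<alpha>) * (z + 1) powr (1 / \<alpha>))"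
    using assms by (intro mult_left_mono) auto
  then show ?thesis by (simp add: weight_def mult.assoc)
qed

section \<open>Numerical inequalities behind the constant of the competitive ratio\<close>

lemma power_mean_3:
  fixes p q r \<alpha> :: real
  assumes "1 < \<alpha>" "0 \<le> p" "0 \<le> q" "0 \<le> r"
  shows "(p + q + r) powr \<alpha> \<le> 3 powr (\<alpha> - 1) * (p powr \<alpha> + q powr \<alpha> + r powr \<alpha>)"
proof -
  \<comment> \<open>Young's inequality with \<open>z = M powr \<alpha>\<close> is the tangent bound
    to the power function at the mean \<open>M\<close>; adding it for \<open>p\<close>,
    \<open>q\<close>, \<open>r\<close> yields convexity.\<close>
  define M where "M = (p + q + r) / 3"
  have M: "0 \<le> M" using assms by (simp add: M_def)
  have z: "(M powr \<alpha>) powr (1 - 1 / \<alpha>) = M powr (\<alpha> - 1)"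
    using assms by (simp add: powr_powr right_diff_distrib)
  have Y: "\<alpha> * M powr (\<alpha> - 1) * s \<le> s powr \<alpha> + (\<alpha> - 1) * M powr \<alpha>" if "0 \<le> s" for s
    using Youngs_inequality_power[of \<alpha> s "M powr \<alpha>"] that assms by (simp add: z)
  have MM: "M powr (\<alpha> - 1) * M = M powr \<alpha>"
    using M assms by (cases "M = 0") (auto simp: powr_diff)
  have "\<alpha> * M powr (\<alpha> - 1) * p + \<alpha> * M powr (\<alpha> - 1) * q + \<alpha> * M powr (\<alpha> - 1) * r
      = \<alpha> * (M powr (\<alpha> - 1) * M) * 3"
    by (simp add: M_def algebra_simps)
  then have "\<alpha> * M powr \<alpha> * 3 \<le> p powr \<alpha> + q powr \<alpha> + r powr \<alpha> + 3 * ((\<alpha> - 1) * M powr \<alpha>)"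
    using Y[of p] Y[of q] Y[of r] assms by (simp add: MM)
  then have *: "3 * M powr \<alpha> \<le> p powr \<alpha> + q powr \<alpha> + r powr \<alpha>"
    by (simp add: algebra_simps)
  have "p + q + r = 3 * M" by (simp add: M_def)
  then have "(p + q + r) powr \<alpha> = (3 * M) powr \<alpha>" by simp
  also have "\<dots> = 3 powr (\<alpha> - 1) * (3 * M powr \<alpha>)"
    using M by (simp add: powr_mult powr_diff)
  also have "\<dots> \<le> 3 powr (\<alpha> - 1) * (p powr \<alpha> + q powr \<alpha> + r powr \<alpha>)"
    using * by (intro mult_left_mono) auto
  finally show ?thesis .
qed

text \<open>Weighted arithmetic-geometric means of 3 and 1 with weights \<open>\<alpha> - 1\<close>
  and \<open>2 - \<alpha>\<close>.\<close>

lemma three_powr_le: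
  fixes \<alpha> :: real
  assumes "1 < \<alpha>" "\<alpha> < 2"
  shows "3 powr (\<alpha> - 1) \<le> 2 * \<alpha> - 1"
  using Youngs_inequality_0[of "\<alpha> - 1" "2 - \<alpha>" 3 1] assms by simp

text \<open>With \<open>y = 3 powr (\<alpha> - 1)\<close> these are the conditions that
  \<open>Phi_drift\<close> imposes on the competitor's power, unfinished map tasks and blocked
  reduce tasks, in this order. Collected on one side, \<open>y\<close> has a nonnegative coefficient
  and may be replaced by \<open>2 * \<alpha> - 1\<close>; multiplying by
  \<open>b = 2 - \<alpha>\<close> leaves polynomial inequalities on
  \<open>0 < b < 1\<close>.\<close>

lemma ratio_bounds:
  fixes \<alpha> y :: real
  assumes "1 < \<alpha>" "\<alpha> < 2" "0 \<le> y" "y \<le> 2 * \<alpha> - 1"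
  shows "(1 + \<alpha>) * (1 + 2 * y) \<le> 7 + 4 / (2 - \<alpha>)"
    and "\<alpha> * (1 + 3 * y) \<le> 8 + 4 / (2 - \<alpha>) + 3 * y"
    and "\<alpha> * (1 + \<alpha>) * (1 + 2 * y) \<le> 8 + 4 / (2 - \<alpha>) + 3 * y"
proof -
  define b where "b = 2 - \<alpha>"
  have b: "0 < b" "b < 1" and \<alpha>: "\<alpha> = 2 - b" using assms by (auto simp: b_def)
  have b3: "b ^ 3 \<le> b ^ 2" using b by (intro power_decreasing) auto
  have b4: "0 \<le> b ^ 3" "0 \<le> b ^ 4" using b by auto
  have quad: "0 \<le> (b - c)\<^sup>2" for c :: real by simp
  have div: "x \<le> 4 / b" if "x * b \<le> 4" for x
    using that b by (simp add: pos_le_divide_eq)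
  have "(1 + \<alpha>) * (1 + 2 * y) \<le> (1 + \<alpha>) * (1 + 2 * (2 * \<alpha> - 1))"
    using assms by (intro mult_left_mono) auto
  moreover have "(1 + \<alpha>) * (1 + 2 * (2 * \<alpha> - 1)) - 7 \<le> 4 / b"
  proof (rule div)
    \<comment> \<open>After \<open>b ^ 3 \<le> b ^ 2\<close> the bound
      \<open>14 * b - 15 * b ^ 2 \<le> 4\<close> remains; its left side is largest at
      \<open>b = 7/15\<close>, hence that square.\<close>
    have "((1 + \<alpha>) * (1 + 2 * (2 * \<alpha> - 1)) - 7) * b = 14 * b - 19 * b ^ 2 + 4 * b ^ 3"
      unfolding \<alpha> by (simp add: algebra_simps power2_eq_square power3_eq_cube)
    then show "((1 + \<alpha>) * (1 + 2 * (2 * \<alpha> - 1)) - 7) * b \<le> 4"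
      using b3 quad[of "7/15"] by (simp add: power2_diff power2_eq_square[of "7/15"])
  qed
  ultimately show "(1 + \<alpha>) * (1 + 2 * y) \<le> 7 + 4 / (2 - \<alpha>)" unfolding b_def by linarith
  have "3 * (\<alpha> - 1) * y \<le> 3 * (\<alpha> - 1) * (2 * \<alpha> - 1)"
    using assms by (intro mult_left_mono) auto
  moreover have "3 * (\<alpha> - 1) * (2 * \<alpha> - 1) + \<alpha> - 8 \<le> 4 / b"
  proof (rule div)
    have "(3 * (\<alpha> - 1) * (2 * \<alpha> - 1) + \<alpha> - 8) * b = 3 * b - 16 * b ^ 2 + 6 * b ^ 3"
      unfolding \<alpha> by (simp add: algebra_simps power2_eq_square power3_eq_cube)
    then show "(3 * (\<alpha> - 1) * (2 * \<alpha> - 1) + \<alpha> - 8) * b \<le> 4"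
      using b3 b zero_le_power2[of b] by linarith
  qed
  ultimately show "\<alpha> * (1 + 3 * y) \<le> 8 + 4 / (2 - \<alpha>) + 3 * y"
    unfolding b_def by (simp add: algebra_simps)
  have "1 * 1 \<le> \<alpha> * \<alpha>" using assms by (intro mult_mono) auto
  then have "0 \<le> 2 * (\<alpha> * (1 + \<alpha>)) - 3" using assms by (simp add: algebra_simps)
  then have "(2 * (\<alpha> * (1 + \<alpha>)) - 3) * y \<le> (2 * (\<alpha> * (1 + \<alpha>)) - 3) * (2 * \<alpha> - 1)"
    using assms by (intro mult_left_mono) auto
  moreover have "(2 * (\<alpha> * (1 + \<alpha>)) - 3) * (2 * \<alpha> - 1) + \<alpha> * (1 + \<alpha>) - 8 \<le> 4 / b"
  proof (rule div)
    \<comment> \<open>The factor next to \<open>1 - b\<close> is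
      \<open>32 * b ^ 2 - 21 * b + 4\<close> with its square completed; its discriminant is
      negative.\<close>
    have "4 - ((2 * (\<alpha> * (1 + \<alpha>)) - 3) * (2 * \<alpha> - 1) + \<alpha> * (1 + \<alpha>) - 8) * b
        = (1 - b) * (32 * (b - 21/64)\<^sup>2 + 71/128) + 5 * b ^ 3 + 4 * b ^ 4"
      unfolding \<alpha> by (simp add: field_simps power2_eq_square power3_eq_cube power4_eq_xxxx)
    moreover have "0 \<le> (1 - b) * (32 * (b - 21/64)\<^sup>2 + 71/128)"
      using b by (intro mult_nonneg_nonneg add_nonneg_nonneg) auto
    ultimately show "((2 * (\<alpha> * (1 + \<alpha>)) - 3) * (2 * \<alpha> - 1) + \<alpha> * (1 + \<alpha>) - 8) * b \<le> 4"
      using b4 by linarith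
  qed
  ultimately show "\<alpha> * (1 + \<alpha>) * (1 + 2 * y) \<le> 8 + 4 / (2 - \<alpha>) + 3 * y"
    unfolding b_def by (simp add: algebra_simps)
qed

section \<open>Consequences of the processing rule\<close>

abbreviation rate :: "real \<Rightarrow> nat \<Rightarrow> real" where
  "rate \<alpha> n \<equiv> (real n + 1) powr (1 / \<alpha>)"

lemma alg_ruleE:
  assumes "alg_rule I \<alpha> S"
  obtains x1 x2 x3 where
    "umaps I S t \<noteq> {} \<Longrightarrow> x1 \<in> umaps I S t \<and> (\<forall>y \<in> umaps I S t. rem I S x1 t \<le> rem I S y t)"
    "umaps I S t \<noteq> {} \<Longrightarrow> x2 \<in> umaps I S t \<and> (\<forall>j \<in> ajobs I S t. cumrem I S (job x2) t \<le> cumrem I S j t)"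
    "freereds I S t \<noteq> {} \<Longrightarrow> x3 \<in> freereds I S t \<and> (\<forall>y \<in> freereds I S t. rem I S x3 t \<le> rem I S y t)"
    "\<And>x. S x t = (if umaps I S t \<noteq> {} \<and> x = x1 then rate \<alpha> (card (umaps I S t)) else 0)
        + (if umaps I S t \<noteq> {} \<and> x = x2 then rate \<alpha> (nred I * card (ajobs I S t)) else 0)
        + (if freereds I S t \<noteq> {} \<and> x = x3 then rate \<alpha> (card (freereds I S t)) else 0)"
  using assms unfolding alg_rule_def by metis

text \<open>Only a lower bound on the speed of \<open>x1\<close> is available, since the task may
  also be the one chosen by M2, and then the rates add. The same holds for M2 below.\<close>

lemma alg_M1:
  assumes "alg_rule I \<alpha> S"
  obtains x1 where
    "umaps I S t \<noteq> {} \<Longrightarrow> x1 \<in> umaps I S t \<and> (\<forall>y \<in> umaps I S t. rem I S x1 t \<le> rem I S y t)"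
    "umaps I S t \<noteq> {} \<Longrightarrow> rate \<alpha> (card (umaps I S t)) \<le> S x1 t"
proof (rule alg_ruleE[OF assms, of t])
  fix x1 x2 x3
  assume min: "umaps I S t \<noteq> {} \<Longrightarrow> x1 \<in> umaps I S t \<and> (\<forall>y \<in> umaps I S t. rem I S x1 t \<le> rem I S y t)"
    and S: "\<And>x. S x t = (if umaps I S t \<noteq> {} \<and> x = x1 then rate \<alpha> (card (umaps I S t)) else 0)
        + (if umaps I S t \<noteq> {} \<and> x = x2 then rate \<alpha> (nred I * card (ajobs I S t)) else 0)
        + (if freereds I S t \<noteq> {} \<and> x = x3 then rate \<alpha> (card (freereds I S t)) else 0)"
  show thesis by (rule that[of x1]) (use min S in \<open>auto simp del: of_nat_mult\<close>)
qed

lemma alg_M2: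
  assumes "alg_rule I \<alpha> S"
  obtains x2 where
    "umaps I S t \<noteq> {} \<Longrightarrow> x2 \<in> umaps I S t \<and> (\<forall>j \<in> ajobs I S t. cumrem I S (job x2) t \<le> cumrem I S j t)"
    "umaps I S t \<noteq> {} \<Longrightarrow> rate \<alpha> (nred I * card (ajobs I S t)) \<le> S x2 t"
proof (rule alg_ruleE[OF assms, of t])
  fix x1 x2 x3
  assume min: "umaps I S t \<noteq> {} \<Longrightarrow> x2 \<in> umaps I S t \<and> (\<forall>j \<in> ajobs I S t. cumrem I S (job x2) t \<le> cumrem I S j t)"
    and S: "\<And>x. S x t = (if umaps I S t \<noteq> {} \<and> x = x1 then rate \<alpha> (card (umaps I S t)) else 0)
        + (if umaps I S t \<noteq> {} \<and> x = x2 then rate \<alpha> (nred I * card (ajobs I S t)) else 0)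
        + (if freereds I S t \<noteq> {} \<and> x = x3 then rate \<alpha> (card (freereds I S t)) else 0)"
  show thesis by (rule that[of x2]) (use min S in \<open>auto simp del: of_nat_mult\<close>)
qed

lemma alg_Rf:
  assumes "alg_rule I \<alpha> S"
  obtains x3 where
    "freereds I S t \<noteq> {} \<Longrightarrow> x3 \<in> freereds I S t \<and> (\<forall>y \<in> freereds I S t. rem I S x3 t \<le> rem I S y t)"
    "freereds I S t \<noteq> {} \<Longrightarrow> rate \<alpha> (card (freereds I S t)) \<le> S x3 t"
proof (rule alg_ruleE[OF assms, of t])
  fix x1 x2 x3
  assume min: "freereds I S t \<noteq> {} \<Longrightarrow> x3 \<in> freereds I S t \<and> (\<forall>y \<in> freereds I S t. rem I S x3 t \<le> rem I S y t)"
    and S: "\<And>x. S x t = (if umaps I S t \<noteq> {} \<and> x = x1 then rate \<alpha> (card (umaps I S t)) else 0)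
        + (if umaps I S t \<noteq> {} \<and> x = x2 then rate \<alpha> (nred I * card (ajobs I S t)) else 0)
        + (if freereds I S t \<noteq> {} \<and> x = x3 then rate \<alpha> (card (freereds I S t)) else 0)"
  show thesis by (rule that[of x3]) (use min S in \<open>auto simp del: of_nat_mult\<close>)
qed

lemma alg_unfinished:
  assumes "alg_rule I \<alpha> S" "S x t \<noteq> 0"
  shows "x \<in> umaps I S t \<union> freereds I S t"
  by (rule alg_ruleE[OF assms(1), of t]) (use assms(2) in \<open>auto split: if_splits\<close>)

lemma alg_nonneg:
  assumes "alg_rule I \<alpha> S" shows "0 \<le> S x t"
  by (rule alg_ruleE[OF assms, of t]) simp

lemma alg_feasible:
  assumes "\<forall>x. S x \<in> borel_measurable lborel" "alg_rule I \<alpha> S"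
  shows "feasible I S"
proof -
  have "S x t = 0" if "t < release I x" for x t
    using alg_unfinished[OF assms(2), of x t] that
    by (auto simp: umaps_def freereds_def unfinished_def)
  moreover have "is_done I S (MapT i k') t" if "S (RedT i k) t \<noteq> 0" "k' < nmap I i" for i k k' t
    using alg_unfinished[OF assms(2), of "RedT i k" t] that
    by (auto simp: umaps_def freereds_def)
  ultimately show ?thesis
    using assms(1) alg_nonneg[OF assms(2)] unfolding feasible_def by blast
qed

text \<open>The rates depend only on task counts. The uniform bound makes the work done in any
  bounded time span finite.\<close>

lemma alg_bounded:
  assumes "alg_rule I \<alpha> S" "0 < \<alpha>"
  shows "S x t \<le> 3 * (real ((nred I + 1) * card (tasks I)) + 1) powr (1 / \<alpha>)"
proof -
  have m: "card (umaps I S t) \<le> card (tasks I)"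
    by (rule card_mono) (auto simp: umaps_def unfinished_def)
  have f: "card (freereds I S t) \<le> card (tasks I)"
    by (rule card_mono) (auto simp: freereds_def unfinished_def)
  have "finite (umaps I S t)"
    by (rule finite_subset[of _ "tasks I"]) (auto simp: umaps_def unfinished_def)
  then have "card (ajobs I S t) \<le> card (tasks I)"
    unfolding ajobs_def using m card_image_le order_trans by blast
  then have j: "nred I * card (ajobs I S t) \<le> nred I * card (tasks I)"
    by (rule mult_le_mono2)
  let ?M = "(real ((nred I + 1) * card (tasks I)) + 1) powr (1 / \<alpha>)"
  have le: "rate \<alpha> n \<le> ?M" if "n \<le> nred I * card (tasks I) \<or> n \<le> card (tasks I)" for n
  proof -
    have "n \<le> (nred I + 1) * card (tasks I)" using that by auto
    then have "real n + 1 \<le> real ((nred I + 1) * card (tasks I)) + 1"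
      by (simp only: of_nat_le_iff add_le_cancel_right)
    then show ?thesis using assms(2) by (intro powr_mono2) auto
  qed
  have if_le: "(if b then rate \<alpha> n else 0) \<le> ?M"
    if "n \<le> nred I * card (tasks I) \<or> n \<le> card (tasks I)" for b n
    using le[OF that] powr_ge_zero[of "real ((nred I + 1) * card (tasks I)) + 1" "1 / \<alpha>"]
    by (simp del: of_nat_mult of_nat_add)
  show ?thesis
  proof (rule alg_ruleE[OF assms(1), of t])
    fix x1 x2 x3
    assume "\<And>x. S x t = (if umaps I S t \<noteq> {} \<and> x = x1 then rate \<alpha> (card (umaps I S t)) else 0)
        + (if umaps I S t \<noteq> {} \<and> x = x2 then rate \<alpha> (nred I * card (ajobs I S t)) else 0)
        + (if freereds I S t \<noteq> {} \<and> x = x3 then rate \<alpha> (card (freereds I S t)) else 0)"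
    then have "S x t \<le> ?M + ?M + ?M"
      by (simp only:) (intro add_mono if_le disjI1 disjI2 j m f)
    then show ?thesis by linarith
  qed
qed

lemma alg_mr_run:
  assumes "\<forall>x. S x \<in> borel_measurable lborel" "alg_rule I \<alpha> S" "valid_instance I" "0 < \<alpha>"
  shows "mr_run I S"
proof
  show "valid_instance I" by fact
  show feas: "feasible I S" using assms alg_feasible by blast
  fix x t
  let ?M = "3 * (real ((nred I + 1) * card (tasks I)) + 1) powr (1 / \<alpha>)"
  have "work S x t \<le> (\<integral>\<^sup>+u. ennreal ?M * indicator {release I x..t} u \<partial>lborel)"
    unfolding work_def
  proof (rule nn_integral_mono)
    fix u
    show "ennreal (S x u) * indicator {..t} u \<le> ennreal ?M * indicator {release I x..t} u"
      using alg_bounded[OF assms(2,4), of x u] feas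
      by (cases "u < release I x") (auto simp: feasible_def ennreal_leI split: split_indicator)
  qed
  also have "\<dots> = ennreal ?M * emeasure lborel {release I x..t}"
    by (rule nn_integral_cmult_indicator) simp
  also have "\<dots> < \<infinity>" by (simp add: ennreal_mult_less_top emeasure_lborel_Icc_eq)
  finally show "work S x t < \<infinity>" .
qed

text \<open>Since \<open>s \<le> 1 + s powr \<alpha>\<close>, the work done up to time
  \<open>t\<close> is at most the time elapsed since release plus the total energy, which the cost
  bounds.\<close>

lemma finite_cost_mr_run:
  assumes "valid_instance I" "feasible I T" "1 < \<alpha>" and fin: "cost I \<alpha> T < \<infinity>"
  shows "mr_run I T"
proof
  show "valid_instance I" "feasible I T" by fact+
  fix x t assume x: "x \<in> tasks I"
  have [measurable]: "T y \<in> borel_measurable borel" and T0: "0 \<le> T y u" for y u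
    using assms(2) by (auto simp: feasible_def)
  let ?s = "\<lambda>u. \<Sum>x\<in>tasks I. T x u"
  have le: "T x u \<le> 1 + ?s u powr \<alpha>" for u
  proof -
    have "T x u \<le> ?s u" using x T0 by (intro member_le_sum) auto
    also have "\<dots> \<le> 1 + ?s u powr \<alpha>"
    proof (cases "?s u \<le> 1")
      case True
      moreover have "0 \<le> ?s u powr \<alpha>" by simp
      ultimately show ?thesis by linarith
    next
      case False
      then have "?s u powr 1 \<le> ?s u powr \<alpha>" using assms(3) by (intro powr_mono) auto
      then show ?thesis using False by simp
    qed
    finally show ?thesis .
  qed
  have "work T x t \<le> (\<integral>\<^sup>+u. indicator {release I x..t} u + ennreal (?s u powr \<alpha>) \<partial>lborel)"
    unfolding work_def
  proof (rule nn_integral_mono)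
    fix u
    have "ennreal (T x u) \<le> 1 + ennreal (?s u powr \<alpha>)"
      using ennreal_leI[OF le[of u]] by (simp add: ennreal_plus)
    moreover have "u < release I x \<Longrightarrow> T x u = 0" using assms(2) by (simp add: feasible_def)
    ultimately show "ennreal (T x u) * indicator {..t} u \<le> indicator {release I x..t} u + ennreal (?s u powr \<alpha>)"
      by (cases "u < release I x") (auto split: split_indicator)
  qed
  also have "\<dots> = emeasure lborel {release I x..t} + (\<integral>\<^sup>+u. ennreal (?s u powr \<alpha>) \<partial>lborel)"
    by (subst nn_integral_add) auto
  also have "(\<integral>\<^sup>+u. ennreal (?s u powr \<alpha>) \<partial>lborel) \<le> cost I \<alpha> T"
    unfolding cost_def by (intro nn_integral_mono ennreal_leI) simp
  also have "emeasure lborel {release I x..t} + cost I \<alpha> T < \<infinity>"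
    using fin by (simp add: emeasure_lborel_Icc_eq)
  finally show "work T x t < \<infinity>" by (simp add: add_left_mono)
qed

section \<open>Drift of the three potentials\<close>

lemma eventually_at_right_ball_less:
  fixes t :: real
  assumes "finite X" "\<And>x. x \<in> X \<Longrightarrow> t < r x"
  shows "eventually (\<lambda>u. \<forall>x\<in>X. u < r x) (at_right t)"
proof (intro eventually_ball_finite ballI)
  fix x assume "x \<in> X"
  then show "eventually (\<lambda>u. u < r x) (at_right t)"
    using assms by (auto simp: eventually_at_right_field intro!: exI[of _ "r x"])
qed (rule assms)

locale mr_comparison = A: mr_run I S + O: mr_run I T for I S T +
  fixes \<alpha> :: real
  assumes \<alpha>: "1 < \<alpha>" and alg: "alg_rule I \<alpha> S"
begin

text \<open>The total work bounds every remaining task size and every cumulative job size, so the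
  level of the processed item never exceeds the cutoff.\<close>

definition "B = (\<Sum>x\<in>tasks I. tsize I x)"

definition "map_potential t = level_potential (weight \<alpha> 1) (map_tasks I) B (\<lambda>x. rem I S x t) (\<lambda>x. rem I T x t)"

definition "job_potential t = level_potential (weight \<alpha> (real (nred I))) {..<njobs I} B
   (\<lambda>i. job_rem I S i t) (\<lambda>i. job_rem I T i t)"

definition "reduce_potential t = level_potential (weight \<alpha> 1) (reduce_tasks I) B (\<lambda>x. rem I S x t) (\<lambda>x. rem I T x t)"

abbreviation "map_speed t \<equiv> \<Sum>x\<in>map_tasks I. T x t"
abbreviation "reduce_speed t \<equiv> \<Sum>x\<in>reduce_tasks I. T x t"

lemma map_tasks_subset: "map_tasks I \<subseteq> tasks I" and reduce_tasks_subset: "reduce_tasks I \<subseteq> tasks I"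
  by (auto simp: map_tasks_def reduce_tasks_def)

lemma tsize_le_B: "x \<in> tasks I \<Longrightarrow> tsize I x \<le> B"
  unfolding B_def using A.size_pos by (intro member_le_sum) (auto simp: less_imp_le)

lemma rem_le_B: "x \<in> tasks I \<Longrightarrow> rem I S x t \<le> B"
  using tsize_le_B A.rem_le_size order_trans by blast

lemma job_rem_le_B:
  assumes "i < njobs I" shows "job_rem I S i t \<le> B"
proof -
  have "job_rem I S i t \<le> (\<Sum>k<nmap I i. tsize I (MapT i k))"
    unfolding job_rem_def using A.rem_le_size A.size_pos assms
    by (intro sum_mono max.boundedI) (auto simp: less_imp_le simp del: tsize.simps)
  also have "\<dots> = sum (tsize I) (MapT i ` {..<nmap I i})"
    by (simp add: sum.reindex inj_on_def)
  also have "\<dots> \<le> B"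
    unfolding B_def using assms A.size_pos by (intro sum_mono2) (auto simp: less_imp_le simp del: tsize.simps)
  finally show ?thesis .
qed

text \<open>With \<open>m\<close> and \<open>m'\<close> unfinished map tasks on the two sides, M1
  works on the smallest of the \<open>m\<close>, so the surplus at its levels is at least
  \<open>m - m'\<close>. The decrease \<open>\<alpha> * (m - m')\<close> against Young's
  \<open>(\<alpha> - 1) * m\<close> leaves \<open>- m + \<alpha> * m'\<close>.\<close>

lemma map_potential_drift:
  assumes reg: "A.regular_time t" "O.regular_time t" and e: "e > 0"
  shows "eventually (\<lambda>u. map_potential u \<le> map_potential t + (u - t) *
     (map_speed t powr \<alpha> - real (card (umaps I S t)) + \<alpha> * real (card (umaps I T t)) + e)) (at_right t)"
proof -
  obtain x1 where x1: "umaps I S t \<noteq> {} \<Longrightarrow> x1 \<in> umaps I S t \<and> (\<forall>y \<in> umaps I S t. rem I S x1 t \<le> rem I S y t)"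
    and rate1: "umaps I S t \<noteq> {} \<Longrightarrow> rate \<alpha> (card (umaps I S t)) \<le> S x1 t"
    using alg_M1[OF alg, of t] by metis
  define m where "m = card (umaps I S t)"
  define m' where "m' = card (umaps I T t)"
  define R where "R = {x \<in> map_tasks I. release I x \<le> t}"
  have ne: "umaps I S t \<noteq> {}" if "0 < m - m'" using that by (auto simp: m_def)
  have x1t: "x1 \<in> tasks I" "0 < rem I S x1 t" "x1 \<in> map_tasks I" if "0 < m - m'"
    using x1[OF ne[OF that]] by (auto simp: A.umaps_eq map_tasks_def)
  have "eventually (\<lambda>u. map_potential u \<le> map_potential t + (u - t) *
      (weight \<alpha> 1 m * map_speed t - weight \<alpha> 1 (m - m') * rate \<alpha> m + e)) (at_right t)"
    unfolding map_potential_def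
  proof (rule level_potential_drift[where R = R and x = x1])
    show "mono (weight \<alpha> 1)" using \<alpha> by (intro mono_weight) auto
    show "\<forall>\<^sub>F u in at_right t. \<forall>i\<in>map_tasks I - R. rem I T i u = rem I S i t"
      by (rule eventually_mono[OF eventually_at_right_ball_less[of "map_tasks I - R" t "release I"]]) (simp_all add: R_def O.rem_before_release A.rem_before_release not_le)
    show "card {i \<in> R. 0 < rem I S i t} \<le> m"
      by (simp add: m_def A.umaps_eq R_def)
    show "\<forall>\<^sub>F u in at_right t. (\<Sum>i\<in>map_tasks I. rem I T i t - rem I T i u) \<le> (u - t) * (map_speed t + e)"
      if "e > 0" for e
      using O.regular_rem_sum[OF reg(2) map_tasks_subset that] .
    show "x1 \<in> map_tasks I \<and> 0 < rem I S x1 t \<and> rem I S x1 t \<le> B \<and>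
        m - m' + card {i \<in> R. 0 < rem I T i t} \<le> card {i \<in> R. rem I S x1 t \<le> rem I S i t}"
      if "0 < m - m'"
    proof -
      have "m' = card {i \<in> R. 0 < rem I T i t}" by (simp add: m'_def O.umaps_eq R_def)
      moreover have "m \<le> card {i \<in> R. rem I S x1 t \<le> rem I S i t}"
        unfolding m_def using x1[OF ne[OF that]]
        by (intro card_mono) (auto simp: R_def A.umaps_eq)
      ultimately show ?thesis using x1t[OF that] that rem_le_B by simp
    qed
    show "\<forall>\<^sub>F u in at_right t. rem I S x1 u \<le> rem I S x1 t - (u - t) * (rate \<alpha> m - e)"
      if "0 < m - m'" "0 < e" for e
      using A.regular_rem[OF reg(1) x1t(1)[OF that(1)] that(2)] rate1[OF ne[OF that(1)]]
      by (simp add: m_def)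
  qed (use e A.rem_antimono O.rem_antimono map_tasks_subset in \<open>auto simp: R_def\<close>)
  moreover have "eventually (\<lambda>u. t < u) (at_right t)"
    by (rule eventually_at_right_less)
  ultimately show ?thesis
  proof eventually_elim
    case (elim u)
    have "weight \<alpha> 1 m * map_speed t \<le> map_speed t powr \<alpha> + (\<alpha> - 1) * real m"
      using weight_speed_le[of \<alpha> "map_speed t" 1 m] \<alpha> O.S_nonneg by (simp add: sum_nonneg)
    moreover have "\<alpha> * real (m - m') \<le> weight \<alpha> 1 (m - m') * rate \<alpha> m"
      using weight_speed_ge[of \<alpha> 1 "m - m'" "real m"] \<alpha> by simp
    \<comment> \<open>\<open>m - m'\<close> on the right is truncated subtraction: if the competitor
      has more tasks, the decrease is estimated by 0.\<close>
    moreover have "\<alpha> * (real m - real m') \<le> \<alpha> * real (m - m')" using \<alpha> by (intro mult_left_mono) auto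
    ultimately have "weight \<alpha> 1 m * map_speed t - weight \<alpha> 1 (m - m') * rate \<alpha> m + e
        \<le> map_speed t powr \<alpha> - real m + \<alpha> * real m' + e"
      by (simp add: algebra_simps)
    then have "(u - t) * (weight \<alpha> 1 m * map_speed t - weight \<alpha> 1 (m - m') * rate \<alpha> m + e)
        \<le> (u - t) * (map_speed t powr \<alpha> - real m + \<alpha> * real m' + e)"
      using elim by (intro mult_left_mono) auto
    then show ?case using elim unfolding m_def m'_def by linarith
  qed
qed

text \<open>The same argument with jobs as items: M2 advances the job of smallest cumulative
  remainder, and its rate is matched to the weight by taking \<open>c = nred I\<close>. The
  competitor's rate of change is bounded by its map speed alone.\<close>

lemma job_potential_drift:
  assumes reg: "A.regular_time t" "O.regular_time t" and e: "e > 0"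
  shows "eventually (\<lambda>u. job_potential u \<le> job_potential t + (u - t) *
     (map_speed t powr \<alpha> - real (nred I * card (ajobs I S t)) + \<alpha> * real (nred I * card (ajobs I T t)) + e)) (at_right t)"
proof -
  obtain x2 where x2: "umaps I S t \<noteq> {} \<Longrightarrow> x2 \<in> umaps I S t \<and> (\<forall>j \<in> ajobs I S t. cumrem I S (job x2) t \<le> cumrem I S j t)"
    and rate2: "umaps I S t \<noteq> {} \<Longrightarrow> rate \<alpha> (nred I * card (ajobs I S t)) \<le> S x2 t"
    using alg_M2[OF alg, of t] by metis
  define m where "m = card (ajobs I S t)"
  define m' where "m' = card (ajobs I T t)"
  define R where "R = {i \<in> {..<njobs I}. rel I i \<le> t}"
  let ?w = "weight \<alpha> (real (nred I))"
  have ne: "umaps I S t \<noteq> {}" if "0 < m - m'" using that by (auto simp: m_def ajobs_def)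
  \<comment> \<open>The witnesses are tied to the case \<open>0 < m - m'\<close>, because
    \<open>x2\<close> is specified only when map tasks remain.\<close>
  obtain i k where ik: "x2 = MapT i k \<and> i < njobs I \<and> k < nmap I i \<and> 0 < rem I S (MapT i k) t \<and> rel I i \<le> t \<and> i \<in> ajobs I S t"
    if "0 < m - m'"
  proof (cases "0 < m - m'")
    case True
    then have x: "x2 \<in> umaps I S t" using x2[OF ne] by blast
    then obtain i k where "x2 = MapT i k" by (cases x2) (auto simp: umaps_def)
    with x that show ?thesis by (force simp: A.umaps_eq map_tasks_def ajobs_def)
  qed auto
  have "eventually (\<lambda>u. job_potential u \<le> job_potential t + (u - t) *
      (?w m * map_speed t - ?w (m - m') * rate \<alpha> (nred I * m) + e)) (at_right t)"
    unfolding job_potential_def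
  proof (rule level_potential_drift[where R = R and x = i])
    show "mono ?w" using \<alpha> by (intro mono_weight) auto
    show "\<forall>\<^sub>F u in at_right t. \<forall>j\<in>{..<njobs I} - R. job_rem I T j u = job_rem I S j t"
      by (rule eventually_mono[OF eventually_at_right_ball_less[of "{..<njobs I} - R" t "rel I"]])
         (simp_all add: R_def job_rem_def O.rem_before_release A.rem_before_release not_le)
    show "card {i \<in> R. 0 < job_rem I S i t} \<le> m"
      by (simp add: m_def A.ajobs_eq R_def)
    show "\<forall>\<^sub>F u in at_right t. (\<Sum>i<njobs I. job_rem I T i t - job_rem I T i u) \<le> (u - t) * (map_speed t + e)"
      if "e > 0" for e
    proof -
      have "eventually (\<lambda>u. t < u) (at_right t)"
        by (rule eventually_at_right_less)
      with O.regular_rem_sum[OF reg(2) map_tasks_subset that] show ?thesis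
      proof eventually_elim
        case (elim u)
        then show ?case using O.job_rem_decrease_le[of t u] by linarith
      qed
    qed
    show "i \<in> {..<njobs I} \<and> 0 < job_rem I S i t \<and> job_rem I S i t \<le> B \<and>
        m - m' + card {i \<in> R. 0 < job_rem I T i t} \<le> card {j \<in> R. job_rem I S i t \<le> job_rem I S j t}"
      if "0 < m - m'"
    proof -
      note ik = ik[OF that]
      have "m' = card {i \<in> R. 0 < job_rem I T i t}" by (simp add: m'_def O.ajobs_eq R_def)
      moreover have "m \<le> card {j \<in> R. job_rem I S i t \<le> job_rem I S j t}"
        unfolding m_def
      proof (intro card_mono subsetI)
        fix j assume j: "j \<in> ajobs I S t"
        then have jR: "j \<in> R" by (auto simp: A.ajobs_eq R_def)
        have "cumrem I S i t \<le> cumrem I S j t" using x2[OF ne[OF that]] ik j by auto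
        then show "j \<in> {j \<in> R. job_rem I S i t \<le> job_rem I S j t}"
          using ik jR A.cumrem_eq_job_rem[of i t] A.cumrem_eq_job_rem[of j t] by (auto simp: R_def)
      qed (auto simp: R_def)
      moreover have "0 < job_rem I S i t" using ik A.ajobs_eq by auto
      ultimately show ?thesis using ik that job_rem_le_B by simp
    qed
    show "\<forall>\<^sub>F u in at_right t. job_rem I S i u \<le> job_rem I S i t - (u - t) * (rate \<alpha> (nred I * m) - e)"
      if "0 < m - m'" "0 < e" for e
      using A.regular_job_rem[OF reg(1), of i k e "rate \<alpha> (nred I * m)"] ik[OF that(1)]
        rate2[OF ne[OF that(1)]] that(2) by (simp only: m_def)
  qed (use e A.job_rem_antimono O.job_rem_antimono in \<open>auto simp: R_def\<close>)
  moreover have "eventually (\<lambda>u. t < u) (at_right t)"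
    by (rule eventually_at_right_less)
  ultimately show ?thesis
  proof eventually_elim
    case (elim u)
    have "?w m * map_speed t \<le> map_speed t powr \<alpha> + (\<alpha> - 1) * real (nred I * m)"
      using weight_speed_le[of \<alpha> "map_speed t" "real (nred I)" m] \<alpha> O.S_nonneg by (simp add: sum_nonneg)
    moreover have "\<alpha> * real (nred I * (m - m')) \<le> ?w (m - m') * rate \<alpha> (nred I * m)"
      using weight_speed_ge[of \<alpha> "real (nred I)" "m - m'" "real (nred I * m)"] \<alpha>
      by (simp add: mult_left_mono)
    moreover have "\<alpha> * (real (nred I * m) - real (nred I * m')) \<le> \<alpha> * real (nred I * (m - m'))"
      using \<alpha> by (intro mult_left_mono) (auto simp: right_diff_distrib'[symmetric] mult_left_mono)
    ultimately have "?w m * map_speed t - ?w (m - m') * rate \<alpha> (nred I * m) + e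
        \<le> map_speed t powr \<alpha> - real (nred I * m) + \<alpha> * real (nred I * m') + e"
      by (simp only: right_diff_distrib left_diff_distrib mult_1_left)
    then have "(u - t) * (?w m * map_speed t - ?w (m - m') * rate \<alpha> (nred I * m) + e)
        \<le> (u - t) * (map_speed t powr \<alpha> - real (nred I * m) + \<alpha> * real (nred I * m') + e)"
      using elim by (intro mult_left_mono) auto
    then show ?case using elim unfolding m_def m'_def by linarith
  qed
qed

text \<open>The algorithm's blocked reduce tasks count in the upper bound \<open>N\<close> on the
  surplus. They give nothing to the lower bound, because they may be smaller than the free task
  \<open>x3\<close>. Young's inequality therefore costs \<open>\<alpha> - 1\<close> per free or
  blocked task, while the decrease is \<open>\<alpha>\<close> times the free count minus all of the
  competitor's reduce tasks.\<close>

lemma reduce_potential_drift: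
  assumes reg: "A.regular_time t" "O.regular_time t" and e: "e > 0"
  shows "eventually (\<lambda>u. reduce_potential u \<le> reduce_potential t + (u - t) *
     (reduce_speed t powr \<alpha> + (\<alpha> - 1) * real (card (freereds I S t) + nred I * card (ajobs I S t))
      - \<alpha> * real (card (freereds I S t)) + \<alpha> * real (card (freereds I T t) + nred I * card (ajobs I T t)) + e)) (at_right t)"
proof -
  obtain x3 where x3: "freereds I S t \<noteq> {} \<Longrightarrow> x3 \<in> freereds I S t \<and> (\<forall>y \<in> freereds I S t. rem I S x3 t \<le> rem I S y t)"
    and rate3: "freereds I S t \<noteq> {} \<Longrightarrow> rate \<alpha> (card (freereds I S t)) \<le> S x3 t"
    using alg_Rf[OF alg, of t] by metis
  define m where "m = card (freereds I S t)"
  define m' where "m' = card (freereds I T t) + nred I * card (ajobs I T t)"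
  define N where "N = card (freereds I S t) + nred I * card (ajobs I S t)"
  define R where "R = {x \<in> reduce_tasks I. release I x \<le> t}"
  have ne: "freereds I S t \<noteq> {}" if "0 < m - m'" using that by (auto simp: m_def)
  have fr: "x \<in> R \<and> x \<in> tasks I \<and> 0 < rem I S x t" if "x \<in> freereds I S t" for x
    using that by (auto simp: freereds_def A.unfinished_iff reduce_tasks_def R_def)
  have "eventually (\<lambda>u. reduce_potential u \<le> reduce_potential t + (u - t) *
      (weight \<alpha> 1 N * reduce_speed t - weight \<alpha> 1 (m - m') * rate \<alpha> m + e)) (at_right t)"
    unfolding reduce_potential_def
  proof (rule level_potential_drift[where R = R and x = x3])
    show "mono (weight \<alpha> 1)" using \<alpha> by (intro mono_weight) auto
    show "\<forall>\<^sub>F u in at_right t. \<forall>i\<in>reduce_tasks I - R. rem I T i u = rem I S i t"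
      by (rule eventually_mono[OF eventually_at_right_ball_less[of "reduce_tasks I - R" t "release I"]]) (simp_all add: R_def O.rem_before_release A.rem_before_release not_le)
    show "card {i \<in> R. 0 < rem I S i t} \<le> N"
      unfolding N_def R_def A.card_unfinished_reduce ..
    show "\<forall>\<^sub>F u in at_right t. (\<Sum>i\<in>reduce_tasks I. rem I T i t - rem I T i u) \<le> (u - t) * (reduce_speed t + e)"
      if "e > 0" for e
      using O.regular_rem_sum[OF reg(2) reduce_tasks_subset that] .
    show "x3 \<in> reduce_tasks I \<and> 0 < rem I S x3 t \<and> rem I S x3 t \<le> B \<and>
        m - m' + card {i \<in> R. 0 < rem I T i t} \<le> card {i \<in> R. rem I S x3 t \<le> rem I S i t}"
      if "0 < m - m'"
    proof -
      have "m' = card {i \<in> R. 0 < rem I T i t}" unfolding m'_def R_def O.card_unfinished_reduce ..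
      moreover have "m \<le> card {i \<in> R. rem I S x3 t \<le> rem I S i t}"
        unfolding m_def using x3[OF ne[OF that]] fr
        by (intro card_mono) (auto simp: R_def)
      ultimately show ?thesis using fr[of x3] x3[OF ne[OF that]] that rem_le_B by (simp add: R_def)
    qed
    show "\<forall>\<^sub>F u in at_right t. rem I S x3 u \<le> rem I S x3 t - (u - t) * (rate \<alpha> m - e)"
      if "0 < m - m'" "0 < e" for e
      using A.regular_rem[OF reg(1) _ that(2), of x3 "rate \<alpha> m"] rate3[OF ne[OF that(1)]]
        fr[of x3] x3[OF ne[OF that(1)]] by (simp add: m_def)
  qed (use e A.rem_antimono O.rem_antimono reduce_tasks_subset in \<open>auto simp: R_def\<close>)
  moreover have "eventually (\<lambda>u. t < u) (at_right t)"
    by (rule eventually_at_right_less)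
  ultimately show ?thesis
  proof eventually_elim
    case (elim u)
    have "weight \<alpha> 1 N * reduce_speed t \<le> reduce_speed t powr \<alpha> + (\<alpha> - 1) * real N"
      using weight_speed_le[of \<alpha> "reduce_speed t" 1 N] \<alpha> O.S_nonneg by (simp add: sum_nonneg)
    moreover have "\<alpha> * real (m - m') \<le> weight \<alpha> 1 (m - m') * rate \<alpha> m"
      using weight_speed_ge[of \<alpha> 1 "m - m'" "real m"] \<alpha> by simp
    moreover have "\<alpha> * (real m - real m') \<le> \<alpha> * real (m - m')" using \<alpha> by (intro mult_left_mono) auto
    ultimately have "weight \<alpha> 1 N * reduce_speed t - weight \<alpha> 1 (m - m') * rate \<alpha> m + e
        \<le> reduce_speed t powr \<alpha> + (\<alpha> - 1) * real N - \<alpha> * real m + \<alpha> * real m' + e"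
      by (simp add: right_diff_distrib)
    then have "(u - t) * (weight \<alpha> 1 N * reduce_speed t - weight \<alpha> 1 (m - m') * rate \<alpha> m + e)
        \<le> (u - t) * (reduce_speed t powr \<alpha> + (\<alpha> - 1) * real N - \<alpha> * real m + \<alpha> * real m' + e)"
      using elim by (intro mult_left_mono) auto
    then show ?case using elim unfolding m_def m'_def N_def by linarith
  qed
qed

section \<open>The competitive ratio\<close>

abbreviation "cost_rate U t \<equiv> real (card {x. unfinished I U x t}) + (\<Sum>x\<in>tasks I. U x t) powr \<alpha>"

text \<open>The power of the combined speed is split by the power mean inequality into the powers of
  the three rates, which are the respective counts plus 1.\<close>

lemma alg_cost_rate_le:
  defines "y \<equiv> 3 powr (\<alpha> - 1)"
  shows "cost_rate S t \<le> (1 + 3 * y) * real (card (umaps I S t))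
    + (1 + 2 * y) * real (card (freereds I S t) + nred I * card (ajobs I S t))"
proof -
  define m where "m = card (umaps I S t)"
  define J where "J = nred I * card (ajobs I S t)"
  define f where "f = card (freereds I S t)"
  define p where "p = (if umaps I S t \<noteq> {} then rate \<alpha> m else 0)"
  define q where "q = (if umaps I S t \<noteq> {} then rate \<alpha> J else 0)"
  define r where "r = (if freereds I S t \<noteq> {} then rate \<alpha> f else 0)"
  have m0: "umaps I S t \<noteq> {} \<longleftrightarrow> 0 < m" and f0: "freereds I S t \<noteq> {} \<longleftrightarrow> 0 < f"
    by (auto simp: m_def f_def card_gt_0_iff)
  have y0: "0 \<le> y" by (simp add: y_def)
  have "(\<Sum>x\<in>tasks I. S x t) \<le> p + q + r"
  proof (rule alg_ruleE[OF alg, of t])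
    fix x1 x2 x3
    assume S: "\<And>x. S x t = (if umaps I S t \<noteq> {} \<and> x = x1 then rate \<alpha> (card (umaps I S t)) else 0)
        + (if umaps I S t \<noteq> {} \<and> x = x2 then rate \<alpha> (nred I * card (ajobs I S t)) else 0)
        + (if freereds I S t \<noteq> {} \<and> x = x3 then rate \<alpha> (card (freereds I S t)) else 0)"
    have delta: "(\<Sum>x\<in>tasks I. if b \<and> x = z then rate \<alpha> n else 0) \<le> (if b then rate \<alpha> n else 0)" for b z n
      by (cases b) auto
    have "(\<Sum>x\<in>tasks I. S x t) = (\<Sum>x\<in>tasks I. if umaps I S t \<noteq> {} \<and> x = x1 then rate \<alpha> m else 0)
        + (\<Sum>x\<in>tasks I. if umaps I S t \<noteq> {} \<and> x = x2 then rate \<alpha> J else 0)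
        + (\<Sum>x\<in>tasks I. if freereds I S t \<noteq> {} \<and> x = x3 then rate \<alpha> f else 0)"
      unfolding S m_def J_def f_def sum.distrib ..
    also have "\<dots> \<le> p + q + r"
      unfolding p_def q_def r_def by (intro add_mono delta)
    finally show ?thesis .
  qed
  then have "(\<Sum>x\<in>tasks I. S x t) powr \<alpha> \<le> (p + q + r) powr \<alpha>"
    using \<alpha> A.S_nonneg by (intro powr_mono2) (auto intro: sum_nonneg)
  also have "\<dots> \<le> y * (p powr \<alpha> + q powr \<alpha> + r powr \<alpha>)"
    unfolding y_def using \<alpha> by (intro power_mean_3) (auto simp: p_def q_def r_def)
  \<comment> \<open>The added 1 of Rf is charged to the \<open>f \<ge> 1\<close> free tasks. Those
    of M1 and M2 are both charged to \<open>m \<ge> 1\<close>, since \<open>J\<close> may be 0;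
    hence the coefficient 3.\<close>
  also have "\<dots> \<le> y * (3 * real m + 2 * real J + 2 * real f)"
  proof (intro mult_left_mono y0)
    have pw: "(rate \<alpha> n) powr \<alpha> = real n + 1" for n
      using \<alpha> by (simp add: powr_powr)
    have "r powr \<alpha> \<le> 2 * real f" using f0 by (auto simp: r_def pw)
    moreover have "p powr \<alpha> + q powr \<alpha> \<le> 3 * real m + 2 * real J"
      using m0 by (auto simp: p_def q_def pw)
    ultimately show "p powr \<alpha> + q powr \<alpha> + r powr \<alpha> \<le> 3 * real m + 2 * real J + 2 * real f" by simp
  qed
  finally show ?thesis
    unfolding A.card_unfinished m_def[symmetric] J_def[symmetric] f_def[symmetric]
    by (simp add: algebra_simps)
qed

definition "ratio = 8 + 4 / (2 - \<alpha>) + 3 powr \<alpha>"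

text \<open>The outer weights are the coefficients of \<open>alg_cost_rate_le\<close>. The factor
  \<alpha> on the job potential makes the terms in the blocked tasks \<open>J\<close> add up to
  \<open>- \<alpha> * K * J + (\<alpha> - 1) * K * J = - K * J\<close> with
  \<open>K = 1 + 2 * 3 powr (\<alpha> - 1)\<close>, as required.\<close>

definition "Phi t = (1 + 3 * 3 powr (\<alpha> - 1)) * map_potential t
   + \<alpha> * (1 + 2 * 3 powr (\<alpha> - 1)) * job_potential t + (1 + 2 * 3 powr (\<alpha> - 1)) * reduce_potential t"

text \<open>The algorithm's terms cancel exactly against the bound on its cost rate. What is left is
  linear in the competitor's power, map tasks, free and blocked reduce tasks, and each coefficient
  is compared with \<open>ratio\<close>.\<close>

lemma Phi_drift:
  assumes reg: "A.regular_time t" "O.regular_time t" and e: "e > 0" and \<alpha>2: "\<alpha> < 2"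
  shows "eventually (\<lambda>u. Phi u \<le> Phi t + (u - t) * (ratio * cost_rate T t - cost_rate S t + e)) (at_right t)"
proof -
  define y where "y = 3 powr (\<alpha> - 1)"
  have y0: "0 \<le> y" by (simp add: y_def)
  have y3: "3 powr \<alpha> = 3 * y" by (simp add: y_def powr_diff)
  define K where "K = 1 + 2 * y"
  define c where "c = 1 + 3 * y"
  have K0: "0 \<le> K" "0 \<le> c" using y0 by (auto simp: K_def c_def)
  \<comment> \<open>The sum of the three weights. It is the coefficient of the competitor's power,
    as the map speed enters two potentials and the reduce speed the third, and it also divides the
    error \<open>e\<close>.\<close>
  define C where "C = c + \<alpha> * K + K"
  have aK: "0 \<le> \<alpha> * K" using K0 \<alpha> by simp
  have C0: "0 < C" using aK y0 by (simp add: C_def c_def K_def)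
  have eC: "e / C > 0" using e C0 by simp
  define m where "m = real (card (umaps I S t))"
  define J where "J = real (nred I * card (ajobs I S t))"
  define f where "f = real (card (freereds I S t))"
  define m' where "m' = real (card (umaps I T t))"
  define J' where "J' = real (nred I * card (ajobs I T t))"
  define f' where "f' = real (card (freereds I T t))"
  define p where "p = map_speed t powr \<alpha>"
  define q where "q = reduce_speed t powr \<alpha>"
  define s where "s = (\<Sum>x\<in>tasks I. T x t) powr \<alpha>"
  have nonneg: "0 \<le> m'" "0 \<le> J'" "0 \<le> f'" "0 \<le> s" by (auto simp: m'_def J'_def f'_def s_def)
  have "0 \<le> map_speed t" "0 \<le> reduce_speed t"
    using O.S_nonneg by (auto intro: sum_nonneg)
  then have ps: "p \<le> s" "q \<le> s"
    unfolding p_def q_def s_def sum_tasks_split[of _ I] using \<alpha> by (auto intro!: powr_mono2)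
  have ratio: "ratio = 8 + 4 / (2 - \<alpha>) + 3 * y" by (simp add: ratio_def y3)
  have y2: "y \<le> 2 * \<alpha> - 1" unfolding y_def by (rule three_powr_le[OF \<alpha> \<alpha>2])
  note rb = ratio_bounds[OF \<alpha> \<alpha>2 y0 y2]
  have R1: "C \<le> ratio" using rb(1) unfolding ratio C_def c_def K_def by (simp add: algebra_simps)
  have R2: "\<alpha> * c \<le> ratio" using rb(2) unfolding ratio c_def by simp
  have R3: "\<alpha> * (\<alpha> * K) + \<alpha> * K \<le> ratio" using rb(3) unfolding ratio K_def by (simp add: algebra_simps)
  have "0 \<le> \<alpha> * (\<alpha> * K)" using K0 \<alpha> by (intro mult_nonneg_nonneg) auto
  then have R4: "\<alpha> * K \<le> ratio" using R3 by linarith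
  define d1 where "d1 = p - m + \<alpha> * m'"
  define d2 where "d2 = p - J + \<alpha> * J'"
  define d3 where "d3 = q + (\<alpha> - 1) * (f + J) - \<alpha> * f + \<alpha> * (f' + J')"
  have main: "c * d1 + \<alpha> * K * d2 + K * d3 \<le> ratio * cost_rate T t - cost_rate S t"
  proof -
    have costS: "cost_rate S t \<le> c * m + K * (f + J)"
      using alg_cost_rate_le[of t] unfolding c_def K_def y_def m_def f_def J_def of_nat_add .
    have "c * d1 + \<alpha> * K * d2 + K * d3
        = (c + \<alpha> * K) * p + K * q + (\<alpha> * c) * m' + (\<alpha> * K) * f' + (\<alpha> * (\<alpha> * K) + \<alpha> * K) * J'
          - (c * m + K * (f + J))"
      unfolding d1_def d2_def d3_def by (simp add: algebra_simps)
    also have "\<dots> \<le> (c + \<alpha> * K) * s + K * s + ratio * m' + ratio * f' + ratio * J' - cost_rate S t"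
      by (intro diff_mono[OF _ costS] add_mono mult_right_mono mult_left_mono)
         (use ps K0 aK R2 R3 R4 nonneg in auto)
    also have "(c + \<alpha> * K) * s + K * s = C * s" by (simp add: C_def algebra_simps)
    also have "C * s \<le> ratio * s" using R1 nonneg by (intro mult_right_mono) auto
    also have "ratio * s + ratio * m' + ratio * f' + ratio * J' = ratio * cost_rate T t"
      unfolding O.card_unfinished s_def m'_def f'_def J'_def by (simp add: algebra_simps)
    finally show ?thesis by simp
  qed
  have "eventually (\<lambda>u. t < u) (at_right t)"
    by (rule eventually_at_right_less)
  with map_potential_drift[OF reg eC] job_potential_drift[OF reg eC] reduce_potential_drift[OF reg eC]
  show ?thesis
  proof eventually_elim
    case (elim u)
    have i1: "map_potential u \<le> map_potential t + (u - t) * (d1 + e / C)"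
      using elim(1) by (simp add: d1_def p_def m_def m'_def)
    have i2: "job_potential u \<le> job_potential t + (u - t) * (d2 + e / C)"
      using elim(2) by (simp add: d2_def p_def J_def J'_def)
    have i3: "reduce_potential u \<le> reduce_potential t + (u - t) * (d3 + e / C)"
      using elim(3) by (simp add: d3_def q_def f_def f'_def J_def J'_def)
    have "Phi u \<le> c * (map_potential t + (u - t) * (d1 + e / C)) + \<alpha> * K * (job_potential t + (u - t) * (d2 + e / C))
        + K * (reduce_potential t + (u - t) * (d3 + e / C))"
      unfolding Phi_def y_def[symmetric] c_def[symmetric] K_def[symmetric]
      using i1 i2 i3 K0 aK by (intro add_mono mult_left_mono)
    also have "\<dots> = Phi t + (u - t) * (c * d1 + \<alpha> * K * d2 + K * d3 + C * (e / C))"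
      unfolding Phi_def y_def[symmetric] c_def[symmetric] K_def[symmetric] C_def by (simp only: algebra_simps)
    also have "\<dots> \<le> Phi t + (u - t) * (ratio * cost_rate T t - cost_rate S t + e)"
      using main C0 elim(4) by (intro add_left_mono mult_left_mono) auto
    finally show ?case .
  qed
qed

section \<open>Integration of the drift over time\<close>

definition "L = (1 + 3 * 3 powr (\<alpha> - 1)) * weight \<alpha> 1 (card (map_tasks I))
   + \<alpha> * (1 + 2 * 3 powr (\<alpha> - 1)) * weight \<alpha> (real (nred I)) (njobs I)
   + (1 + 2 * 3 powr (\<alpha> - 1)) * weight \<alpha> 1 (card (reduce_tasks I))"

lemma L_nonneg: "0 \<le> L"
  unfolding L_def using \<alpha> weight_nonneg by (intro add_nonneg_nonneg mult_nonneg_nonneg) auto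

text \<open>Progress of the algorithm only lowers \<open>Phi\<close>, so its growth is bounded by a
  constant times the competitor's work, which is absolutely continuous in time.\<close>

lemma Phi_increase_le:
  assumes "t \<le> u"
  shows "Phi u - Phi t \<le> integral {t..u} (\<lambda>v. L * (\<Sum>x\<in>tasks I. T x v))"
proof -
  let ?W = "\<Sum>x\<in>tasks I. rem I T x t - rem I T x u"
  have nn: "0 \<le> rem I T x t - rem I T x u" if "x \<in> tasks I" for x
    using O.rem_antimono[OF that assms] by simp
  have sub: "(\<Sum>x\<in>X. rem I T x t - rem I T x u) \<le> ?W" if "X \<subseteq> tasks I" for X
    using nn that by (intro sum_mono2) auto
  have mw: "mono (weight \<alpha> c)" if "0 \<le> c" for c using \<alpha> that by (rule mono_weight)
  have anti: "rem I U x u \<le> rem I U x t" if "x \<in> map_tasks I \<or> x \<in> reduce_tasks I" "U = S \<or> U = T" for x U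
    using that A.rem_antimono O.rem_antimono assms map_tasks_subset reduce_tasks_subset by blast
  have "map_potential u - map_potential t \<le> weight \<alpha> 1 (card (map_tasks I)) * (\<Sum>x\<in>map_tasks I. rem I T x t - rem I T x u)"
    unfolding map_potential_def using anti mw by (intro level_potential_increase_le) auto
  also have "\<dots> \<le> weight \<alpha> 1 (card (map_tasks I)) * ?W"
    using sub[OF map_tasks_subset] weight_nonneg[OF \<alpha>] by (intro mult_left_mono)
  finally have 1: "map_potential u - map_potential t \<le> weight \<alpha> 1 (card (map_tasks I)) * ?W" .
  have "job_potential u - job_potential t \<le> weight \<alpha> (real (nred I)) (card {..<njobs I}) * (\<Sum>i<njobs I. job_rem I T i t - job_rem I T i u)"
    unfolding job_potential_def using A.job_rem_antimono O.job_rem_antimono assms mw by (intro level_potential_increase_le) auto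
  also have "\<dots> \<le> weight \<alpha> (real (nred I)) (card {..<njobs I}) * ?W"
    using order_trans[OF O.job_rem_decrease_le[OF assms] sub[OF map_tasks_subset]] weight_nonneg[OF \<alpha>]
    by (intro mult_left_mono)
  finally have 2: "job_potential u - job_potential t \<le> weight \<alpha> (real (nred I)) (njobs I) * ?W" by simp
  have "reduce_potential u - reduce_potential t \<le> weight \<alpha> 1 (card (reduce_tasks I)) * (\<Sum>x\<in>reduce_tasks I. rem I T x t - rem I T x u)"
    unfolding reduce_potential_def using anti mw by (intro level_potential_increase_le) auto
  also have "\<dots> \<le> weight \<alpha> 1 (card (reduce_tasks I)) * ?W"
    using sub[OF reduce_tasks_subset] weight_nonneg[OF \<alpha>] by (intro mult_left_mono)
  finally have 3: "reduce_potential u - reduce_potential t \<le> weight \<alpha> 1 (card (reduce_tasks I)) * ?W" .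
  have "Phi u - Phi t = (1 + 3 * 3 powr (\<alpha> - 1)) * (map_potential u - map_potential t)
      + \<alpha> * (1 + 2 * 3 powr (\<alpha> - 1)) * (job_potential u - job_potential t) + (1 + 2 * 3 powr (\<alpha> - 1)) * (reduce_potential u - reduce_potential t)"
    unfolding Phi_def by (simp only: algebra_simps)
  also have "\<dots> \<le> (1 + 3 * 3 powr (\<alpha> - 1)) * (weight \<alpha> 1 (card (map_tasks I)) * ?W)
      + \<alpha> * (1 + 2 * 3 powr (\<alpha> - 1)) * (weight \<alpha> (real (nred I)) (njobs I) * ?W)
      + (1 + 2 * 3 powr (\<alpha> - 1)) * (weight \<alpha> 1 (card (reduce_tasks I)) * ?W)"
    using \<alpha> by (intro add_mono mult_left_mono 1 2 3) (auto intro!: mult_nonneg_nonneg add_nonneg_nonneg)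
  also have "\<dots> = L * ?W" unfolding L_def by (simp only: algebra_simps)
  also have "?W = (\<Sum>x\<in>tasks I. integral {t..u} (T x))"
    using O.rem_diff assms by (intro sum.cong) auto
  also have "\<dots> = integral {t..u} (\<lambda>v. \<Sum>x\<in>tasks I. T x v)"
    using O.S_integrable_on by (intro integral_sum[symmetric]) auto
  also have "L * \<dots> = integral {t..u} (\<lambda>v. L * (\<Sum>x\<in>tasks I. T x v))"
    by simp
  finally show ?thesis .
qed

lemma Phi_nonneg: "0 \<le> Phi t"
  unfolding Phi_def map_potential_def job_potential_def reduce_potential_def using \<alpha>
  by (intro add_nonneg_nonneg mult_nonneg_nonneg level_potential_nonneg mono_weight) auto

lemma Phi_start:
  assumes "\<And>x. x \<in> tasks I \<Longrightarrow> t < release I x"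
  shows "Phi t = 0"
proof -
  have eq: "rem I S x t = rem I T x t" if "x \<in> tasks I" for x
    using A.rem_before_release O.rem_before_release assms[OF that] by simp
  have "map_potential t = 0" "reduce_potential t = 0"
    unfolding map_potential_def reduce_potential_def using eq map_tasks_subset reduce_tasks_subset
    by (auto intro!: level_potential_eq_0)
  moreover have "job_potential t = 0"
    unfolding job_potential_def job_rem_def by (intro level_potential_eq_0 sum.cong) (auto simp: eq)
  ultimately show ?thesis by (simp add: Phi_def)
qed

lemma alg_cost_rate_bounded: "cost_rate S t \<le> (1 + 3 * 3 powr (\<alpha> - 1)) * real (card (tasks I))"
proof -
  let ?y = "3 powr (\<alpha> - 1)"
  have "cost_rate S t \<le> (1 + 3 * ?y) * real (card (umaps I S t))
    + (1 + 3 * ?y) * real (card (freereds I S t) + nred I * card (ajobs I S t))"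
    by (rule order_trans[OF alg_cost_rate_le]) (intro add_left_mono mult_right_mono, auto)
  also have "\<dots> = (1 + 3 * ?y) * real (card {x. unfinished I S x t})"
    unfolding A.card_unfinished by (simp add: algebra_simps)
  also have "\<dots> \<le> (1 + 3 * ?y) * real (card (tasks I))"
    by (intro mult_left_mono of_nat_mono card_mono) (auto simp: unfinished_def add_nonneg_nonneg)
  finally show ?thesis .
qed

lemma cost_le:
  assumes \<alpha>2: "\<alpha> < 2" and fin: "cost I \<alpha> T < \<infinity>"
  shows "cost I \<alpha> S \<le> ennreal ratio * cost I \<alpha> T"
proof -
  have ratio0: "0 \<le> ratio" using \<alpha>2 by (simp add: ratio_def)
  have rS0: "0 \<le> cost_rate S t" and rT0: "0 \<le> cost_rate T t" for t by auto
  have [measurable]: "cost_rate S \<in> borel_measurable borel" "cost_rate T \<in> borel_measurable borel"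
    by measurable
  have intT: "integrable lborel (cost_rate T)"
    using fin rT0 unfolding cost_def by (intro integrableI_nonneg) auto
  \<comment> \<open>A time before all releases, where the two schedules have equal remainders and
    \<open>Phi\<close> vanishes. Inserting 0 keeps the minimum defined for an instance without
    tasks.\<close>
  define t0 where "t0 = Min (insert 0 (release I ` tasks I)) - 1"
  have t0: "t0 < release I x" if "x \<in> tasks I" for x
  proof -
    have "Min (insert 0 (release I ` tasks I)) \<le> release I x" using that by (intro Min_le) auto
    then show ?thesis by (simp add: t0_def)
  qed
  have before: "cost_rate S t = 0" if "t < t0" for t
  proof -
    have "{x. unfinished I S x t} = {}" using t0 that by (force simp: unfinished_def)
    moreover have "(\<Sum>x\<in>tasks I. S x t) = 0"
      using t0 that by (intro sum.neutral) (force intro: A.S_before_release)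
    ultimately show ?thesis by simp
  qed
  have part: "(\<integral>\<^sup>+t. ennreal (cost_rate S t) * indicator {t0..t1} t \<partial>lborel) \<le> ennreal ratio * cost I \<alpha> T"
    if t1: "t0 \<le> t1" for t1
  proof -
    have iS: "set_integrable lborel {t0..t1} (cost_rate S)"
      unfolding set_integrable_def
    proof (rule Bochner_Integration.integrable_bound)
      show "integrable lborel (\<lambda>t. indicator {t0..t1} t *\<^sub>R ((1 + 3 * 3 powr (\<alpha> - 1)) * real (card (tasks I))))"
        by (intro integrable_scaleR_left integrable_real_indicator)
           (auto simp: emeasure_bounded_finite[unfolded infinity_ennreal_def])
      show "AE t in lborel. norm (indicator {t0..t1} t *\<^sub>R cost_rate S t)
          \<le> norm (indicator {t0..t1} t *\<^sub>R ((1 + 3 * 3 powr (\<alpha> - 1)) * real (card (tasks I))))"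
        using alg_cost_rate_bounded rS0 order_trans[OF _ abs_ge_self]
        by (intro AE_I2) (auto split: split_indicator)
    qed measurable
    have iT: "set_integrable lborel {t0..t1} (cost_rate T)"
      unfolding set_integrable_def using intT by (intro integrable_mult_indicator) auto
    have irT: "set_integrable lborel {t0..t1} (\<lambda>t. ratio * cost_rate T t)"
      using iT by (rule set_integrable_mult_right)
    \<comment> \<open>The potential starts at 0 and stays nonnegative, so its integrated drift is
      nonnegative; rearranged, this compares the two costs on \<open>{t0..t1}\<close>.\<close>
    have "0 \<le> Phi t1 - Phi t0" using Phi_nonneg Phi_start[of t0] t0 by simp
    also have "\<dots> \<le> integral {t0..t1} (\<lambda>t. ratio * cost_rate T t - cost_rate S t)"
    proof (rule AE_Dini_le_integral[where G = "\<lambda>v. L * (\<Sum>x\<in>tasks I. T x v)"])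
      have "integrable lborel (\<lambda>v. \<Sum>x\<in>tasks I. indicator {t0..t1} v *\<^sub>R T x v)"
        using O.S_integrable_Icc unfolding set_integrable_def by (intro Bochner_Integration.integrable_sum) auto
      then have "set_integrable lborel {t0..t1} (\<lambda>v. \<Sum>x\<in>tasks I. T x v)"
        unfolding set_integrable_def scaleR_sum_right .
      then show "set_integrable lborel {t0..t1} (\<lambda>v. L * (\<Sum>x\<in>tasks I. T x v))"
        by (rule set_integrable_mult_right)
      show "0 \<le> L * (\<Sum>x\<in>tasks I. T x v)" for v
        using L_nonneg O.S_nonneg by (intro mult_nonneg_nonneg sum_nonneg)
      show "set_integrable lborel {t0..t1} (\<lambda>t. ratio * cost_rate T t - cost_rate S t)"
        using irT iS by (rule set_integral_diff)
      show "Phi y - Phi x \<le> integral {x..y} (\<lambda>v. L * (\<Sum>x\<in>tasks I. T x v))" if "x \<le> y" for x y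
        using Phi_increase_le[OF that] .
      show "AE t in lborel. t \<in> {t0..<t1} \<longrightarrow> (\<forall>e>0. \<forall>\<^sub>F u in at_right t.
          Phi u \<le> Phi t + (u - t) * (ratio * cost_rate T t - cost_rate S t + e))"
        using A.AE_regular_time O.AE_regular_time
        by eventually_elim (use Phi_drift \<alpha>2 in blast)
    qed (rule t1)
    also have "\<dots> = (LINT t:{t0..t1}|lborel. ratio * cost_rate T t - cost_rate S t)"
      using irT iS by (intro set_borel_integral_eq_integral(2)[symmetric] set_integral_diff)
    also have "\<dots> = (LINT t:{t0..t1}|lborel. ratio * cost_rate T t) - (LINT t:{t0..t1}|lborel. cost_rate S t)"
      using irT iS by (rule set_integral_diff)
    finally have le: "(LINT t:{t0..t1}|lborel. cost_rate S t) \<le> ratio * (LINT t:{t0..t1}|lborel. cost_rate T t)"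
      by simp
    have nn: "(\<integral>\<^sup>+t. ennreal (f t) * indicator {t0..t1} t \<partial>lborel) = ennreal (LINT t:{t0..t1}|lborel. f t)"
      if "set_integrable lborel {t0..t1} f" "\<And>t. 0 \<le> f t" for f :: "real \<Rightarrow> real"
    proof -
      have "(\<integral>\<^sup>+t. ennreal (f t) * indicator {t0..t1} t \<partial>lborel) = (\<integral>\<^sup>+t. ennreal (indicator {t0..t1} t *\<^sub>R f t) \<partial>lborel)"
        by (intro nn_integral_cong) (auto split: split_indicator)
      then show ?thesis
        using that unfolding set_lebesgue_integral_def set_integrable_def
        by (simp add: nn_integral_eq_integral)
    qed
    have "(\<integral>\<^sup>+t. ennreal (cost_rate S t) * indicator {t0..t1} t \<partial>lborel) = ennreal (LINT t:{t0..t1}|lborel. cost_rate S t)"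
      using iS rS0 by (rule nn)
    also have "\<dots> \<le> ennreal (ratio * (LINT t:{t0..t1}|lborel. cost_rate T t))"
      using le by (rule ennreal_leI)
    also have "\<dots> = ennreal ratio * ennreal (LINT t:{t0..t1}|lborel. cost_rate T t)"
      using ratio0 rT0 by (intro ennreal_mult) (auto simp: set_lebesgue_integral_def intro!: integral_nonneg_AE)
    also have "ennreal (LINT t:{t0..t1}|lborel. cost_rate T t)
        = (\<integral>\<^sup>+t. ennreal (cost_rate T t) * indicator {t0..t1} t \<partial>lborel)"
      using iT rT0 by (rule nn[symmetric])
    also have "\<dots> \<le> cost I \<alpha> T"
      unfolding cost_def by (intro nn_integral_mono) (auto split: split_indicator)
    finally show ?thesis by (simp add: mult_left_mono)
  qed
  \<comment> \<open>Monotone convergence along growing windows, as the algorithm's total cost is not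
    known to be finite beforehand. Before \<open>t0\<close> its cost rate is 0.\<close>
  have "cost I \<alpha> S = (\<integral>\<^sup>+t. (SUP n. ennreal (cost_rate S t) * indicator {t0..t0 + real n} t) \<partial>lborel)"
    unfolding cost_def
  proof (intro nn_integral_cong antisym)
    fix t
    show "(SUP n. ennreal (cost_rate S t) * indicator {t0..t0 + real n} t) \<le> ennreal (cost_rate S t)"
      by (intro SUP_least) (auto split: split_indicator)
    show "ennreal (cost_rate S t) \<le> (SUP n. ennreal (cost_rate S t) * indicator {t0..t0 + real n} t)"
    proof (cases "t < t0")
      case False
      obtain n where "t - t0 \<le> real n" using real_arch_simple by blast
      then show ?thesis using False by (intro SUP_upper2[of n]) auto
    qed (simp add: before)
  qed
  also have "\<dots> = (SUP n. \<integral>\<^sup>+t. ennreal (cost_rate S t) * indicator {t0..t0 + real n} t \<partial>lborel)"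
    by (intro nn_integral_monotone_convergence_SUP)
       (auto simp: incseq_def le_fun_def split: split_indicator)
  also have "\<dots> \<le> ennreal ratio * cost I \<alpha> T"
    by (intro SUP_least part) simp
  finally show ?thesis .
qed

end

theorem theorem3:
  fixes I :: mrinst and \<alpha> :: real and S :: schedule
  assumes "1 < \<alpha>" and "\<alpha> < 2"
    and "valid_instance I"
    and "\<forall>x. S x \<in> borel_measurable lborel"
    and "alg_rule I \<alpha> S"
  shows "cost I \<alpha> S \<le> ennreal (8 + 4 / (2 - \<alpha>) + 3 powr \<alpha>) * OPT I \<alpha>"
proof -
  let ?R = "8 + 4 / (2 - \<alpha>) + 3 powr \<alpha>"
  have R0: "0 < ?R" using assms by (intro add_pos_pos) auto
  have le: "cost I \<alpha> S \<le> ennreal ?R * cost I \<alpha> T" if T: "feasible I T" for T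
  \<comment> \<open>A competitor of infinite cost makes the bound trivial, as the ratio is
    positive.\<close>
  proof (cases "cost I \<alpha> T < \<infinity>")
    case True
    interpret mr_comparison I S T \<alpha>
    proof (intro mr_comparison.intro mr_comparison_axioms.intro)
      show "mr_run I S" using assms by (intro alg_mr_run) auto
      show "mr_run I T" using assms T True by (intro finite_cost_mr_run) auto
    qed (use assms in auto)
    show ?thesis using cost_le[OF assms(2) True] by (simp add: ratio_def)
  next
    case False
    then have "cost I \<alpha> T = top" by (simp add: less_top[symmetric])
    then show ?thesis using R0 by (simp add: ennreal_mult_top)
  qed
  \<comment> \<open>The infimum in \<open>OPT\<close> need not be attained. Dividing by the ratio
    turns \<open>le\<close> into a lower bound on the cost of every feasible schedule, hence on the
    infimum.\<close>
  have "cost I \<alpha> S = ennreal ?R * cost I \<alpha> S / ennreal ?R"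
    using R0 mult_divide_eq_ennreal[of "ennreal ?R" "cost I \<alpha> S"] by (simp add: mult.commute)
  also have "\<dots> = ennreal ?R * (cost I \<alpha> S / ennreal ?R)"
    by (simp add: ennreal_times_divide)
  also have "\<dots> \<le> ennreal ?R * OPT I \<alpha>"
    unfolding OPT_def using R0 le
    by (intro mult_left_mono INF_greatest divide_le_posI_ennreal) auto
  finally show ?thesis .
qed

end
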